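(* Let $X$ be a $\sigma$-compact metric space admitting a good covering, and $Y$ a locally Lipschitz contractible metric space. Then the natural map $[X,Y]_{\mathrm{loc}\text{-}\mathrm{Lip}}\to[X,Y]$ is bijective. In particular, every continuous map from $X$ to $Y$ is homotopic to a locally Lipschitz one.
   Context: Lipschitz strong deformation retraction: for a subset $A$ of a metric space $X$, a Lipschitz map $F:X\times[0,1]\to X$ with $F(x,0)=x$, $F(x,1)\in A$ and $F(a,t)=a$ for all $x\in X$, $a\in A$, $t\in[0,1]$ is a Lipschitz strong deformation retraction of $X$ to $A$. Good covering: a locally finite open covering $\mathcal U=\{U_j\}_{j\in J}$ of a metric space $X$ is good if (1) the closure of each element of $\mathcal U$ is compact; (2) every non-empty intersection of finitely many elements of $\mathcal U$ has a Lipschitz strong deformation retraction to a point $p$ of it. $[X,Y]$ is the set of homotopy classes of continuous maps $X\to Y$. Two maps $h_0,h_1:X\to Y$ are locally Lipschitz homotopic if there is a locally Lipschitz map $h:X\times[0,1]\to Y$ with $h(\cdot,i)=h_i$ ($i=0,1$); $[X,Y]_{\mathrm{loc}\text{-}\mathrm{Lip}}$ is the set of locally Lipschitz homotopy classes of locally Lipschitz maps $X\to Y$. The natural map sends the class of a locally Lipschitz map to its homotopy class. Locally Lipschitz contractible: a metric space $Y$ is locally Lipschitz contractible if for every $p\in Y$ and $\epsilon>0$ there exist $r\in(0,\epsilon]$ and a Lipschitz map $\varphi:B(p,r)\times[0,1]\to B(p,\epsilon)$ with $\varphi(x,0)=x$ and $\varphi(x,1)=p$ for all $x\in B(p,r)$,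 where $B(p,r)$ is the open ball. *)

theory Defs
  imports "HOL-Analysis.Analysis"
begin

text \<open>
  Metric spaces are represented as subsets \<open>X\<close> of types of class \<^class>\<open>metric_space\<close> with the
  restricted metric (so the empty space is included), and all topological notions are relative
  to \<open>X\<close>. A map \<open>X \<rightarrow> Y\<close> is a function of the ambient types, whose values outside
  \<open>X\<close> are irrelevant. The product \<open>X \<times> [0,1]\<close> carries the Euclidean product metric.
\<close>

definition sigma_compact :: "'a::topological_space set \<Rightarrow> bool" where
  "sigma_compact X \<longleftrightarrow>
     (\<exists>K :: nat \<Rightarrow> 'a set. (\<forall>n. compact (K n)) \<and> (\<Union>n. K n) = X)"

definition Lipschitz_strong_deformation_retraction ::
    "'a::metric_space set \<Rightarrow> 'a set \<Rightarrow> ('a \<times> real \<Rightarrow> 'a) \<Rightarrow> bool" where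
  "Lipschitz_strong_deformation_retraction X A F \<longleftrightarrow>
     A \<subseteq> X \<and>
     (\<exists>L. L-lipschitz_on (X \<times> {0..1}) F) \<and> F \<in> X \<times> {0..1} \<rightarrow> X \<and>
     (\<forall>x\<in>X. F (x, 0) = x) \<and> (\<forall>x\<in>X. F (x, 1) \<in> A) \<and>
     (\<forall>a\<in>A. \<forall>t\<in>{0..1}. F (a, t) = a)"

definition good_covering :: "'a::metric_space set \<Rightarrow> 'a set set \<Rightarrow> bool" where
  "good_covering X \<U> \<longleftrightarrow>
     (\<forall>U\<in>\<U>. openin (top_of_set X) U) \<and> \<Union>\<U> = X \<and>
     locally_finite_in (top_of_set X) \<U> \<and>
     (\<forall>U\<in>\<U>. compact ((top_of_set X) closure_of U)) \<and>
     (\<forall>\<F>\<subseteq>\<U>. finite \<F> \<and> \<F> \<noteq> {} \<and> \<Inter>\<F> \<noteq> {} \<longrightarrow>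
        (\<exists>p\<in>\<Inter>\<F>. \<exists>F. Lipschitz_strong_deformation_retraction (\<Inter>\<F>) {p} F))"

definition locally_Lipschitz_contractible :: "'b::metric_space set \<Rightarrow> bool" where
  "locally_Lipschitz_contractible Y \<longleftrightarrow>
     (\<forall>p\<in>Y. \<forall>\<epsilon>>0. \<exists>r. 0 < r \<and> r \<le> \<epsilon> \<and>
        (\<exists>\<phi> :: 'b \<times> real \<Rightarrow> 'b.
           (\<exists>L. L-lipschitz_on ((Y \<inter> ball p r) \<times> {0..1}) \<phi>) \<and>
           \<phi> \<in> (Y \<inter> ball p r) \<times> {0..1} \<rightarrow> Y \<inter> ball p \<epsilon> \<and>
           (\<forall>x\<in>Y \<inter> ball p r. \<phi> (x, 0) = x \<and> \<phi> (x, 1) = p)))"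

definition locally_Lipschitz_map ::
    "'a::metric_space set \<Rightarrow> 'b::metric_space set \<Rightarrow> ('a \<Rightarrow> 'b) \<Rightarrow> bool" where
  "locally_Lipschitz_map X Y f \<longleftrightarrow>
     f \<in> X \<rightarrow> Y \<and> (\<forall>x\<in>X. \<exists>r>0. \<exists>L. L-lipschitz_on (X \<inter> ball x r) f)"

definition locally_Lipschitz_homotopic ::
    "'a::metric_space set \<Rightarrow> 'b::metric_space set \<Rightarrow> ('a \<Rightarrow> 'b) \<Rightarrow> ('a \<Rightarrow> 'b) \<Rightarrow> bool" where
  "locally_Lipschitz_homotopic X Y f g \<longleftrightarrow>
     (\<exists>h :: 'a \<times> real \<Rightarrow> 'b. locally_Lipschitz_map (X \<times> {0..1}) Y h \<and>
        (\<forall>x\<in>X. h (x, 0) = f x \<and> h (x, 1) = g x))"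

definition homotopy_rel ::
    "'a::metric_space set \<Rightarrow> 'b::metric_space set \<Rightarrow> (('a \<Rightarrow> 'b) \<times> ('a \<Rightarrow> 'b)) set" where
  "homotopy_rel X Y = {(f, g). homotopic_with_canon (\<lambda>_. True) X Y f g}"

definition locally_Lipschitz_homotopy_rel ::
    "'a::metric_space set \<Rightarrow> 'b::metric_space set \<Rightarrow> (('a \<Rightarrow> 'b) \<times> ('a \<Rightarrow> 'b)) set" where
  "locally_Lipschitz_homotopy_rel X Y = {(f, g). locally_Lipschitz_homotopic X Y f g}"

text \<open>
  Functions that agree on \<open>X\<close> are related by both relations, so the values outside \<open>X\<close>
  do not affect the two quotients below.
\<close>

definition homotopy_classes ::
    "'a::metric_space set \<Rightarrow> 'b::metric_space set \<Rightarrow> ('a \<Rightarrow> 'b) set set" where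
  "homotopy_classes X Y =
     {f. continuous_map (top_of_set X) (top_of_set Y) f} // homotopy_rel X Y"

definition locally_Lipschitz_homotopy_classes ::
    "'a::metric_space set \<Rightarrow> 'b::metric_space set \<Rightarrow> ('a \<Rightarrow> 'b) set set" where
  "locally_Lipschitz_homotopy_classes X Y =
     {f. locally_Lipschitz_map X Y f} // locally_Lipschitz_homotopy_rel X Y"

text \<open>
  The union of the homotopy classes of the members of \<open>C\<close>; all these classes coincide, see
  \<open>natural_map_class\<close> below.
\<close>

definition natural_map ::
    "'a::metric_space set \<Rightarrow> 'b::metric_space set \<Rightarrow> ('a \<Rightarrow> 'b) set \<Rightarrow> ('a \<Rightarrow> 'b) set" where
  "natural_map X Y C = homotopy_rel X Y `` C"

lemma equiv_homotopy_rel: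
  "equiv {f. continuous_map (top_of_set X) (top_of_set Y) f} (homotopy_rel X Y)"
proof (rule equivI)
  show "homotopy_rel X Y \<subseteq> {f. continuous_map (top_of_set X) (top_of_set Y) f} \<times>
      {f. continuous_map (top_of_set X) (top_of_set Y) f}"
    unfolding homotopy_rel_def using homotopic_with_imp_continuous_maps by blast
  show "refl_on {f. continuous_map (top_of_set X) (top_of_set Y) f} (homotopy_rel X Y)"
    unfolding refl_on_def homotopy_rel_def by auto
  show "sym (homotopy_rel X Y)"
    unfolding sym_def homotopy_rel_def by (auto simp: homotopic_with_sym)
  show "trans (homotopy_rel X Y)"
    unfolding trans_def homotopy_rel_def using homotopic_with_trans by blast
qed

lemma locally_Lipschitz_map_imp_continuous_map:
  assumes "locally_Lipschitz_map X Y f"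
  shows "continuous_map (top_of_set X) (top_of_set Y) f"
proof -
  have "continuous_on X f"
    unfolding continuous_on_eq_continuous_within
  proof
    fix x assume x: "x \<in> X"
    then obtain r L where r: "r > 0" "L-lipschitz_on (X \<inter> ball x r) f"
      using assms unfolding locally_Lipschitz_map_def by blast
    have "continuous (at x within X \<inter> ball x r) f"
      using lipschitz_on_continuous_within[OF r(2)] x r(1) by simp
    moreover have "at x within X \<inter> ball x r = at x within X"
      by (rule at_within_nhd[of x "ball x r"]) (use r(1) in auto)
    ultimately show "continuous (at x within X) f" by simp
  qed
  then show ?thesis using assms by (auto simp: locally_Lipschitz_map_def)
qed

lemma locally_Lipschitz_map_compose:
  assumes f: "locally_Lipschitz_map X Y f" and g: "locally_Lipschitz_map Y Z g"
  shows "locally_Lipschitz_map X Z (\<lambda>x. g (f x))"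
  unfolding locally_Lipschitz_map_def
proof (intro conjI ballI)
  show "(\<lambda>x. g (f x)) \<in> X \<rightarrow> Z" using f g by (auto simp: locally_Lipschitz_map_def)
  fix x assume x: "x \<in> X"
  obtain r L where r: "r > 0" "L-lipschitz_on (X \<inter> ball x r) f"
    using f x unfolding locally_Lipschitz_map_def by blast
  have fY: "f \<in> X \<rightarrow> Y" using f by (simp add: locally_Lipschitz_map_def)
  then obtain s M where s: "s > 0" "M-lipschitz_on (Y \<inter> ball (f x) s) g"
    using g x unfolding locally_Lipschitz_map_def by (meson PiE)
  have L: "L \<ge> 0" using r(2) by (rule lipschitz_on_nonneg)
  define u where "u = min r (s / (L + 1))"
  have u: "u > 0" "u \<le> r" "u \<le> s / (L + 1)" using r(1) s(1) L by (auto simp: u_def)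
  have sub: "f ` (X \<inter> ball x u) \<subseteq> Y \<inter> ball (f x) s"
  proof clarify
    fix y assume y: "y \<in> X" "y \<in> ball x u"
    have "dist (f x) (f y) \<le> L * dist x y"
      using lipschitz_onD[OF r(2), of x y] x y u r(1) by auto
    also have "\<dots> \<le> L * u" using L y by (intro mult_left_mono) auto
    also have "\<dots> \<le> L * (s / (L + 1))" using L u by (intro mult_left_mono) auto
    also have "\<dots> < s" using L s(1) by (simp add: field_simps)
    finally show "f y \<in> Y \<inter> ball (f x) s" using y fY by auto
  qed
  have "L-lipschitz_on (X \<inter> ball x u) f"
    using r(2) by (rule lipschitz_on_subset) (use u in auto)
  moreover have "M-lipschitz_on (f ` (X \<inter> ball x u)) g"
    using s(2) sub by (rule lipschitz_on_subset)
  ultimately have "(M * L)-lipschitz_on (X \<inter> ball x u) (\<lambda>x. g (f x))"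
    using lipschitz_on_compose2 by blast
  then show "\<exists>r>0. \<exists>L. L-lipschitz_on (X \<inter> ball x r) (\<lambda>x. g (f x))"
    using u(1) by blast
qed

lemma Lipschitz_imp_locally_Lipschitz_map:
  assumes "L-lipschitz_on X f" "f \<in> X \<rightarrow> Y"
  shows "locally_Lipschitz_map X Y f"
  unfolding locally_Lipschitz_map_def
proof (intro conjI ballI)
  fix x
  have "L-lipschitz_on (X \<inter> ball x 1) f"
    using assms(1) by (rule lipschitz_on_subset) auto
  then show "\<exists>r>0. \<exists>L. L-lipschitz_on (X \<inter> ball x r) f"
    using zero_less_one by blast
qed (use assms in auto)

lemma locally_Lipschitz_map_join:
  fixes k1 k2 :: "'a::metric_space \<times> real \<Rightarrow> 'b::metric_space"
  assumes k1: "locally_Lipschitz_map (X \<times> {a..c}) Y k1"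
    and k2: "locally_Lipschitz_map (X \<times> {c..b}) Y k2"
    and eq: "\<And>x. x \<in> X \<Longrightarrow> k1 (x, c) = k2 (x, c)"
    and c: "a \<le> c" "c \<le> b"
  shows "locally_Lipschitz_map (X \<times> {a..b}) Y (\<lambda>p. if snd p \<le> c then k1 p else k2 p)"
    (is "locally_Lipschitz_map _ _ ?h")
  unfolding locally_Lipschitz_map_def
proof (intro conjI ballI)
  show "?h \<in> X \<times> {a..b} \<rightarrow> Y"
    using k1 k2 by (auto simp: locally_Lipschitz_map_def Pi_iff)
  fix p assume p: "p \<in> X \<times> {a..b}"
  obtain x t where pt: "p = (x, t)" by (cases p)
  have xt: "x \<in> X" "a \<le> t" "t \<le> b" using p pt by auto
  have snd_ball: "\<bar>s - t\<bar> < r" if "(y, s) \<in> ball p r" for y s r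
    using dist_snd_le[of p "(y, s)"] that by (simp add: pt dist_real_def)
  consider "t < c" | "t > c" | "t = c" by linarith
  then show "\<exists>r>0. \<exists>L. L-lipschitz_on (X \<times> {a..b} \<inter> ball p r) ?h"
  proof cases
    case 1
    then obtain r L where r: "r > 0" "L-lipschitz_on (X \<times> {a..c} \<inter> ball p r) k1"
      using k1 xt unfolding locally_Lipschitz_map_def pt
      by (metis atLeastAtMost_iff less_imp_le mem_Sigma_iff)
    define u where "u = min r (c - t)"
    have "L-lipschitz_on (X \<times> {a..b} \<inter> ball p u) k1"
      using r(2) by (rule lipschitz_on_subset) (use snd_ball[of _ _ u] in \<open>fastforce simp: u_def\<close>)
    then have "L-lipschitz_on (X \<times> {a..b} \<inter> ball p u) ?h"
      by (rule lipschitz_on_transform) (use snd_ball[of _ _ u] in \<open>fastforce simp: u_def\<close>)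
    moreover have "u > 0" using r 1 by (simp add: u_def)
    ultimately show ?thesis by blast
  next
    case 2
    then obtain r L where r: "r > 0" "L-lipschitz_on (X \<times> {c..b} \<inter> ball p r) k2"
      using k2 xt unfolding locally_Lipschitz_map_def pt
      by (metis atLeastAtMost_iff less_imp_le mem_Sigma_iff)
    define u where "u = min r (t - c)"
    have "L-lipschitz_on (X \<times> {a..b} \<inter> ball p u) k2"
      using r(2) by (rule lipschitz_on_subset) (use snd_ball[of _ _ u] in \<open>fastforce simp: u_def\<close>)
    then have "L-lipschitz_on (X \<times> {a..b} \<inter> ball p u) ?h"
      by (rule lipschitz_on_transform) (use snd_ball[of _ _ u] in \<open>fastforce simp: u_def\<close>)
    moreover have "u > 0" using r 2 by (simp add: u_def)
    ultimately show ?thesis by blast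
  next
    case 3
    obtain r1 L1 where r1: "r1 > 0" "L1-lipschitz_on (X \<times> {a..c} \<inter> ball p r1) k1"
      using k1 xt 3 unfolding locally_Lipschitz_map_def pt
      by (metis atLeastAtMost_iff order_refl mem_Sigma_iff)
    obtain r2 L2 where r2: "r2 > 0" "L2-lipschitz_on (X \<times> {c..b} \<inter> ball p r2) k2"
      using k2 xt 3 unfolding locally_Lipschitz_map_def pt
      by (metis atLeastAtMost_iff order_refl mem_Sigma_iff)
    have L: "L1 \<ge> 0" "L2 \<ge> 0" using r1 r2 lipschitz_on_nonneg by blast+
    define u where "u = min r1 r2"
    have u: "u > 0" "u \<le> r1" "u \<le> r2" using r1 r2 by (auto simp: u_def)
    define B where "B = X \<times> {a..b} \<inter> ball p u"
    have mid: "dist (k1 (y, s)) (k2 (z, v)) \<le> (L1 + L2) * dist (y, s) (z, v)"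
      if A: "(y, s) \<in> B" "(z, v) \<in> B" and sv: "s \<le> c" "c < v" for y s z v
    proof -
      have "dist p (y, c) \<le> dist p (y, s)"
        by (simp add: pt 3 dist_Pair_Pair real_le_rsqrt)
      then have m: "(y, c) \<in> ball p u" using A by (auto simp: B_def)
      have "dist (k1 (y, s)) (k1 (y, c)) \<le> L1 * dist (y, s) (y, c)"
        by (rule lipschitz_onD[OF r1(2)]) (use A m sv u c in \<open>auto simp: B_def\<close>)
      also have "dist (y, s) (y, c) \<le> dist (y, s) (z, v)"
      proof -
        have "dist (y, s) (y, c) \<le> dist s v"
          using sv by (simp add: dist_Pair_Pair dist_real_def)
        also have "\<dots> \<le> dist (y, s) (z, v)" using dist_snd_le[of "(y, s)" "(z, v)"] by simp
        finally show ?thesis .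
      qed
      finally have 1: "dist (k1 (y, s)) (k1 (y, c)) \<le> L1 * dist (y, s) (z, v)"
        using L by (simp add: mult_left_mono)
      have "dist (k2 (y, c)) (k2 (z, v)) \<le> L2 * dist (y, c) (z, v)"
        by (rule lipschitz_onD[OF r2(2)]) (use A m sv u c in \<open>auto simp: B_def\<close>)
      also have "dist (y, c) (z, v) \<le> dist (y, s) (z, v)"
        using sv by (simp add: dist_Pair_Pair dist_real_def power_mono)
      finally have 2: "dist (k2 (y, c)) (k2 (z, v)) \<le> L2 * dist (y, s) (z, v)"
        using L by (simp add: mult_left_mono)
      have "y \<in> X" using A by (auto simp: B_def)
      then show ?thesis
        using 1 2 dist_triangle[of "k1 (y, s)" "k2 (z, v)" "k2 (y, c)"] eq[of y]
        by (simp add: algebra_simps)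
    qed
    have "(L1 + L2)-lipschitz_on B ?h"
    proof (rule lipschitz_onI)
      fix q q' assume A: "q \<in> B" "q' \<in> B"
      obtain y s z v where q: "q = (y, s)" "q' = (z, v)" by (cases q, cases q')
      consider "s \<le> c" "v \<le> c" | "s \<le> c" "v > c" | "s > c" "v \<le> c" | "s > c" "v > c" 
        by linarith
      then show "dist (?h q) (?h q') \<le> (L1 + L2) * dist q q'"
      proof cases
        case 1
        have "dist (k1 q) (k1 q') \<le> L1 * dist q q'"
          by (rule lipschitz_onD[OF r1(2)]) (use A q 1 u in \<open>auto simp: B_def\<close>)
        also have "\<dots> \<le> (L1 + L2) * dist q q'" using L by (intro mult_right_mono) auto
        finally show ?thesis using 1 q by simp
      next
        case 2
        then show ?thesis using mid[of y s z v] A q by simp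
      next
        case 3
        then show ?thesis using mid[of z v y s] A q by (simp add: dist_commute)
      next
        case 4
        have "dist (k2 q) (k2 q') \<le> L2 * dist q q'"
          by (rule lipschitz_onD[OF r2(2)]) (use A q 4 u in \<open>auto simp: B_def\<close>)
        also have "\<dots> \<le> (L1 + L2) * dist q q'" using L by (intro mult_right_mono) auto
        finally show ?thesis using 4 q by simp
      qed
    qed (use L in simp)
    then show ?thesis using u(1) unfolding B_def by blast
  qed
qed

lemma Lipschitz_reparametrise:
  fixes m b :: real
  shows "\<exists>L. L-lipschitz_on S (\<lambda>p. (fst p, m * snd p + b))"
proof -
  have "1-lipschitz_on S fst" "1-lipschitz_on S snd"
    using dist_fst_le dist_snd_le by (auto simp: lipschitz_on_def)
  then have "(sqrt (1\<^sup>2 + (\<bar>m\<bar> * 1 + 0)\<^sup>2))-lipschitz_on S (\<lambda>p. (fst p, m * snd p + b))"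
    by (intro lipschitz_on_Pair lipschitz_on_add lipschitz_on_cmult_real lipschitz_on_constant)
  then show ?thesis by blast
qed

lemma locally_Lipschitz_map_reparametrise:
  fixes m b :: real
  assumes "locally_Lipschitz_map (X \<times> T) Y h" "\<And>t. t \<in> S \<Longrightarrow> m * t + b \<in> T"
  shows "locally_Lipschitz_map (X \<times> S) Y (\<lambda>p. h (fst p, m * snd p + b))"
proof -
  obtain L where "L-lipschitz_on (X \<times> S) (\<lambda>p. (fst p, m * snd p + b))"
    using Lipschitz_reparametrise by blast
  then have "locally_Lipschitz_map (X \<times> S) (X \<times> T) (\<lambda>p. (fst p, m * snd p + b))"
    by (rule Lipschitz_imp_locally_Lipschitz_map) (use assms(2) in auto)
  then show ?thesis using locally_Lipschitz_map_compose assms(1) by blast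
qed

lemma locally_Lipschitz_map_cong:
  assumes "locally_Lipschitz_map X Y f" "\<And>x. x \<in> X \<Longrightarrow> f x = g x"
  shows "locally_Lipschitz_map X Y g"
proof -
  have "L-lipschitz_on (X \<inter> ball x r) g" if "L-lipschitz_on (X \<inter> ball x r) f" for L x r
    using that by (rule lipschitz_on_transform) (use assms(2) in auto)
  then show ?thesis using assms unfolding locally_Lipschitz_map_def by (metis Pi_cong)
qed

lemma locally_Lipschitz_homotopic_imp_maps:
  fixes f g :: "'a::metric_space \<Rightarrow> 'b::metric_space"
  assumes "locally_Lipschitz_homotopic X Y f g"
  shows "locally_Lipschitz_map X Y f" "locally_Lipschitz_map X Y g"
proof -
  obtain h :: "'a \<times> real \<Rightarrow> 'b" where h: "locally_Lipschitz_map (X \<times> {0..1}) Y h"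
      "\<forall>x\<in>X. h (x, 0) = f x \<and> h (x, 1) = g x"
    using assms unfolding locally_Lipschitz_homotopic_def by blast
  have *: "locally_Lipschitz_map X Y (\<lambda>x. h (x, t))" if "t \<in> {0..1}" for t
  proof -
    have "1-lipschitz_on X (\<lambda>x. (x, t))"
      by (rule lipschitz_onI) (auto simp: dist_Pair_Pair)
    then have "locally_Lipschitz_map X (X \<times> {0..1}) (\<lambda>x. (x, t))"
      by (rule Lipschitz_imp_locally_Lipschitz_map) (use that in auto)
    then show ?thesis using locally_Lipschitz_map_compose h(1) by blast
  qed
  show "locally_Lipschitz_map X Y f"
    using *[of 0] by (rule locally_Lipschitz_map_cong) (use h in auto)
  show "locally_Lipschitz_map X Y g"
    using *[of 1] by (rule locally_Lipschitz_map_cong) (use h in auto)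
qed

lemma equiv_locally_Lipschitz_homotopy_rel:
  fixes X :: "'a::metric_space set" and Y :: "'b::metric_space set"
  shows "equiv {f. locally_Lipschitz_map X Y f} (locally_Lipschitz_homotopy_rel X Y)"
proof (rule equivI)
  show "locally_Lipschitz_homotopy_rel X Y \<subseteq>
      {f. locally_Lipschitz_map X Y f} \<times> {f. locally_Lipschitz_map X Y f}"
    unfolding locally_Lipschitz_homotopy_rel_def
    using locally_Lipschitz_homotopic_imp_maps by blast
  show "refl_on {f. locally_Lipschitz_map X Y f} (locally_Lipschitz_homotopy_rel X Y)"
  proof (rule refl_onI)
    fix f assume "f \<in> {f. locally_Lipschitz_map X Y f}"
    moreover have "locally_Lipschitz_map (X \<times> {0..1::real}) X fst"
      by (rule Lipschitz_imp_locally_Lipschitz_map[of 1])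
        (use dist_fst_le in \<open>auto simp: lipschitz_on_def\<close>)
    ultimately have "locally_Lipschitz_map (X \<times> {0..1::real}) Y (\<lambda>p. f (fst p))"
      using locally_Lipschitz_map_compose by blast
    then show "(f, f) \<in> locally_Lipschitz_homotopy_rel X Y"
      unfolding locally_Lipschitz_homotopy_rel_def locally_Lipschitz_homotopic_def
      by fastforce
  qed
  show "sym (locally_Lipschitz_homotopy_rel X Y)"
  proof (rule symI)
    fix f g :: "'a \<Rightarrow> 'b" assume "(f, g) \<in> locally_Lipschitz_homotopy_rel X Y"
    then obtain h :: "'a \<times> real \<Rightarrow> 'b" where h: "locally_Lipschitz_map (X \<times> {0..1}) Y h"
      "\<forall>x\<in>X. h (x, 0) = f x \<and> h (x, 1) = g x"
      unfolding locally_Lipschitz_homotopy_rel_def locally_Lipschitz_homotopic_def by blast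
    have "locally_Lipschitz_map (X \<times> {0..1}) Y (\<lambda>p. h (fst p, (-1) * snd p + 1))"
      by (rule locally_Lipschitz_map_reparametrise[OF h(1)]) auto
    then show "(g, f) \<in> locally_Lipschitz_homotopy_rel X Y"
      unfolding locally_Lipschitz_homotopy_rel_def locally_Lipschitz_homotopic_def
      using h(2) by (auto intro!: exI[of _ "\<lambda>p. h (fst p, (-1) * snd p + 1)"])
  qed
  show "trans (locally_Lipschitz_homotopy_rel X Y)"
  proof (rule transI)
    fix f1 f2 f3 :: "'a \<Rightarrow> 'b"
    assume "(f1, f2) \<in> locally_Lipschitz_homotopy_rel X Y"
      "(f2, f3) \<in> locally_Lipschitz_homotopy_rel X Y"
    then obtain h k :: "'a \<times> real \<Rightarrow> 'b" where h: "locally_Lipschitz_map (X \<times> {0..1}) Y h"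
      "\<forall>x\<in>X. h (x, 0) = f1 x \<and> h (x, 1) = f2 x"
      and k: "locally_Lipschitz_map (X \<times> {0..1}) Y k"
      "\<forall>x\<in>X. k (x, 0) = f2 x \<and> k (x, 1) = f3 x"
      unfolding locally_Lipschitz_homotopy_rel_def locally_Lipschitz_homotopic_def by blast
    have "locally_Lipschitz_map (X \<times> {0..1/2}) Y (\<lambda>p. h (fst p, 2 * snd p + 0))"
      by (rule locally_Lipschitz_map_reparametrise[OF h(1)]) auto
    moreover have "locally_Lipschitz_map (X \<times> {1/2..1}) Y (\<lambda>p. k (fst p, 2 * snd p + (-1)))"
      by (rule locally_Lipschitz_map_reparametrise[OF k(1)]) auto
    ultimately have "locally_Lipschitz_map (X \<times> {0..1}) Y
      (\<lambda>p. if snd p \<le> 1/2 then h (fst p, 2 * snd p + 0) else k (fst p, 2 * snd p + (-1)))"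
      by (rule locally_Lipschitz_map_join) (use h k in auto)
    then have "locally_Lipschitz_homotopic X Y f1 f3"
      unfolding locally_Lipschitz_homotopic_def using h(2) k(2) by - (rule exI, rule conjI, assumption, auto)
    then show "(f1, f3) \<in> locally_Lipschitz_homotopy_rel X Y"
      by (simp add: locally_Lipschitz_homotopy_rel_def)
  qed
qed

lemma locally_Lipschitz_homotopic_imp_homotopic:
  fixes f g :: "'a::metric_space \<Rightarrow> 'b::metric_space"
  assumes "locally_Lipschitz_homotopic X Y f g"
  shows "homotopic_with_canon (\<lambda>_. True) X Y f g"
proof -
  obtain h :: "'a \<times> real \<Rightarrow> 'b" where h: "locally_Lipschitz_map (X \<times> {0..1}) Y h"
      "\<forall>x\<in>X. h (x, 0) = f x \<and> h (x, 1) = g x"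
    using assms unfolding locally_Lipschitz_homotopic_def by blast
  have c: "continuous_on (X \<times> {0..1}) h" "h \<in> X \<times> {0..1} \<rightarrow> Y"
    using locally_Lipschitz_map_imp_continuous_map[OF h(1)] by auto
  have "continuous_on ({0..1} \<times> X) (\<lambda>p. h (snd p, fst p))"
    by (rule continuous_on_compose2[OF c(1)]) (auto intro!: continuous_intros)
  then have "continuous_map (top_of_set ({0..1} \<times> X)) (top_of_set Y) (\<lambda>p. h (snd p, fst p))"
    using c(2) by (auto simp: Pi_iff)
  moreover have "prod_topology (top_of_set {0..1::real}) (top_of_set X) = top_of_set ({0..1} \<times> X)"
    by (simp add: subtopology_Times flip: euclidean_product_topology)
  ultimately have "homotopic_with_canon (\<lambda>_. True) X Y (\<lambda>x. h (x, 0)) (\<lambda>x. h (x, 1))"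
    unfolding homotopic_with_def by (intro exI[of _ "\<lambda>p. h (snd p, fst p)"]) auto
  then show ?thesis by (rule homotopic_with_eq) (use h(2) in auto)
qed

lemma natural_map_class:
  assumes "locally_Lipschitz_map X Y f"
  shows "natural_map X Y (locally_Lipschitz_homotopy_rel X Y `` {f}) = homotopy_rel X Y `` {f}"
proof -
  have "(f, f) \<in> locally_Lipschitz_homotopy_rel X Y"
    using equiv_class_self[OF equiv_locally_Lipschitz_homotopy_rel] assms by blast
  moreover have "locally_Lipschitz_homotopy_rel X Y \<subseteq> homotopy_rel X Y"
    using locally_Lipschitz_homotopic_imp_homotopic
    unfolding locally_Lipschitz_homotopy_rel_def homotopy_rel_def by blast
  moreover have "trans (homotopy_rel X Y)"
    using equiv_homotopy_rel by (rule equivE)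
  ultimately show ?thesis
    unfolding natural_map_def by (auto dest: transD)
qed

end

theory Submission
  imports Defs
begin

text \<open>
  The proof rests on one explicit construction. Let \<open>u\<close> be a finitely supported vector of
  nonnegative weights. The index sets \<open>\<sigma>\<close> all of whose weights exceed all weights outside
  \<open>\<sigma>\<close>, and exceed \<open>0\<close>, form a chain; the amount by which they do is the gap of \<open>\<sigma>\<close>. Suppose
  that every \<open>\<sigma>\<close> comes with a Lipschitz contraction \<open>F \<sigma>\<close> of a domain \<open>D \<sigma>\<close> that ends at one
  point, and that \<open>F \<sigma>\<close> maps into the domains of all smaller index sets. Apply these contractions
  along the chain, from the largest set to the smallest one, each for the time
  \<open>s * min 1 gap\<close>. A set enters or leaves the chain only when its gap is \<open>0\<close>, where its
  contraction is the identity; so the composition is Lipschitz in the point, in \<open>u\<close> and in \<open>s\<close>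
  jointly. If moreover the largest weight is at least the number of positive weights, then one of the
  gaps is at least \<open>1\<close>: at \<open>s = 1\<close> the corresponding contraction runs to its end and
  forgets the point. The end value is then a Lipschitz function of the weights alone
  (\<open>contract_layers_dist\<close> and \<open>contract_layers_dist_full\<close>).

  The construction is used twice. First, for a good covering of \<open>X\<close>, let the weight of \<open>U\<close> be a
  multiple of the distance to the complement of \<open>U\<close>, and take the given retractions of the finite
  intersections. This yields a locally Lipschitz homotopy from the identity of \<open>X\<close> to a map
  \<open>\<psi>\<close> that is locally a Lipschitz function of finitely many weights
  (\<open>good_covering_deformation\<close>); in effect, \<open>\<psi>\<close> factors through the nerve of the
  covering, with the weights in the role of barycentric coordinates.

  Secondly, for a continuous \<open>G\<close> on \<open>X \<times> [0,1]\<close>, consider \<open>(x, s) \<mapsto> G (\<psi> x, s)\<close>. It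
  depends on finitely many real coordinates near each point. Cubical grids in these
  coordinates cover \<open>X \<times> [0,1]\<close> by sets on which the map varies as little as desired, while the
  number of sets meeting at a point is bounded independently of the mesh (\<open>fine_product_cover\<close>).
  In \<open>Y\<close> a contraction of a small ball may leave that ball but stays within a larger one. A
  sequence of radii, in which each ball contracts within half the ball of the preceding radius
  (\<open>ex_contraction_ladder\<close>), allows as many successive contractions as the order of the cover
  requires, and this is why that order must be known before the mesh is chosen. The construction then
  gives a homotopy from \<open>G (\<psi> x, s)\<close> to a locally Lipschitz map, and this homotopy is locally
  Lipschitz wherever the map \<open>G (\<psi> x, s)\<close> already is
  (\<open>homotopy_smoothing\<close>).

  Surjectivity follows by taking \<open>G (x, s) = f x\<close>. For injectivity, let \<open>G\<close> be a
  homotopy between locally Lipschitz maps \<open>f\<close> and \<open>g\<close>, and let \<open>H\<close> be the locally Lipschitz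
  approximation of \<open>G (\<psi> x, s)\<close>. Then
  \<open>f \<sim> f \<circ> \<psi> \<sim> H (_, 0) \<sim> H (_, 1) \<sim> g \<circ> \<psi> \<sim> g\<close>, all through locally
  Lipschitz homotopies; the second and the fourth one are the parts of the approximating homotopy
  over the ends of \<open>[0,1]\<close>.
\<close>

section \<open>The chain of gaps of a weight vector\<close>

definition supp :: "('i \<Rightarrow> real) \<Rightarrow> 'i set" where
  "supp u = {i. u i \<noteq> 0}"

text \<open>
  The \<open>0\<close> inserted below makes the gap of \<open>\<sigma>\<close> at most the least weight on \<open>\<sigma>\<close> even if
  \<open>\<sigma>\<close> contains every index, so that only subsets of the support have a positive gap.
\<close>

definition gap :: "'i set \<Rightarrow> ('i \<Rightarrow> real) \<Rightarrow> real" where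
  "gap \<sigma> u = Min (u ` \<sigma>) - Max (insert 0 (u ` (- \<sigma>)))"

definition weight :: "'i set \<Rightarrow> ('i \<Rightarrow> real) \<Rightarrow> real" where
  "weight \<sigma> u = max 0 (min 1 (gap \<sigma> u))"

definition layer :: "('i \<Rightarrow> real) \<Rightarrow> nat \<Rightarrow> 'i set \<Rightarrow> bool" where
  "layer u k \<sigma> \<longleftrightarrow> finite \<sigma> \<and> \<sigma> \<noteq> {} \<and> card \<sigma> = k \<and> 0 < gap \<sigma> u"

lemma le_gap_iff:
  assumes "finite (supp u)" "finite \<sigma>" "\<sigma> \<noteq> {}"
  shows "g \<le> gap \<sigma> u \<longleftrightarrow> (\<forall>i\<in>\<sigma>. g \<le> u i \<and> (\<forall>j\<in>- \<sigma>. u j + g \<le> u i))"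
proof -
  have "u ` (- \<sigma>) \<subseteq> insert 0 (u ` supp u)" by (auto simp: supp_def)
  then have fin: "finite (insert 0 (u ` (- \<sigma>)))"
    using assms(1) by (metis finite_imageI finite_insert finite_subset)
  have "g \<le> gap \<sigma> u \<longleftrightarrow> Max (insert 0 (u ` (- \<sigma>))) + g \<le> Min (u ` \<sigma>)"
    by (auto simp: gap_def)
  also have "\<dots> \<longleftrightarrow> (\<forall>i\<in>\<sigma>. Max (insert 0 (u ` (- \<sigma>))) \<le> u i - g)"
    using assms by (auto simp: algebra_simps)
  also have "\<dots> \<longleftrightarrow> (\<forall>i\<in>\<sigma>. \<forall>v\<in>insert 0 (u ` (- \<sigma>)). v \<le> u i - g)"
    using fin by (subst Max_le_iff) auto
  also have "\<dots> \<longleftrightarrow> (\<forall>i\<in>\<sigma>. g \<le> u i \<and> (\<forall>j\<in>- \<sigma>. u j + g \<le> u i))"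
    by (auto simp: algebra_simps)
  finally show ?thesis .
qed

lemma layer_subset_supp:
  assumes "finite (supp u)" "layer u k \<sigma>"
  shows "\<sigma> \<subseteq> supp u"
  using assms le_gap_iff[of u \<sigma> "gap \<sigma> u"] by (force simp: layer_def supp_def)

lemma gap_perturb:
  assumes "finite (supp u)" "finite (supp v)" "finite \<sigma>" "\<sigma> \<noteq> {}" "\<And>i. \<bar>u i - v i\<bar> \<le> \<delta>"
  shows "gap \<sigma> u \<le> gap \<sigma> v + 2 * \<delta>"
proof -
  have "gap \<sigma> u - 2 * \<delta> \<le> gap \<sigma> v"
    unfolding le_gap_iff[OF assms(2-4)]
  proof (intro ballI conjI)
    fix i assume i: "i \<in> \<sigma>"
    have *: "gap \<sigma> u \<le> u i" "\<forall>j\<in>- \<sigma>. u j + gap \<sigma> u \<le> u i"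
      using le_gap_iff[OF assms(1,3,4), of "gap \<sigma> u"] i by auto
    show "gap \<sigma> u - 2 * \<delta> \<le> v i" using * assms(5)[of i] by linarith
    fix j assume "j \<in> - \<sigma>"
    then have "u j + gap \<sigma> u \<le> u i" using * by blast
    then show "v j + (gap \<sigma> u - 2 * \<delta>) \<le> v i"
      using assms(5)[of i] assms(5)[of j] by linarith
  qed
  then show ?thesis by simp
qed

text \<open>
  If an index \<open>i\<close> of \<open>\<tau>\<close> is missing in \<open>\<sigma>\<close>, then by cardinality some \<open>j\<close> in \<open>\<sigma>\<close> is
  missing in \<open>\<tau>\<close>; the vectors order \<open>i\<close> and \<open>j\<close> oppositely, which costs the sum of both gaps.
  Hence the sets present for nearby vectors agree, unless their gaps are small. With \<open>u = v\<close>
  this says that the sets with positive gap form a chain.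
\<close>

lemma layer_exchange:
  assumes u: "finite (supp u)" "layer u k \<sigma>" and v: "finite (supp v)" "layer v l \<tau>"
    and "l \<le> k" "\<not> \<tau> \<subseteq> \<sigma>" "\<And>i. \<bar>u i - v i\<bar> \<le> \<delta>"
  shows "gap \<sigma> u + gap \<tau> v \<le> 2 * \<delta>"
proof -
  have fin: "finite \<sigma>" "\<sigma> \<noteq> {}" "finite \<tau>" "\<tau> \<noteq> {}" "card \<tau> \<le> card \<sigma>"
    using assms by (auto simp: layer_def)
  obtain i where i: "i \<in> \<tau>" "i \<notin> \<sigma>" using assms by blast
  have "\<not> \<sigma> \<subseteq> \<tau>" using fin i by (metis card_seteq)
  then obtain j where j: "j \<in> \<sigma>" "j \<notin> \<tau>" by blast
  have "u i + gap \<sigma> u \<le> u j" using le_gap_iff[of u \<sigma> "gap \<sigma> u"] u fin i j by auto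
  moreover have "v j + gap \<tau> v \<le> v i" using le_gap_iff[of v \<tau> "gap \<tau> v"] v fin i j by auto
  ultimately show ?thesis using assms(7)[of i] assms(7)[of j] by linarith
qed

lemma layer_chain:
  assumes "finite (supp u)" "layer u k \<sigma>" "layer u l \<tau>" "l \<le> k"
  shows "\<tau> \<subseteq> \<sigma>"
proof (rule ccontr)
  assume "\<not> \<tau> \<subseteq> \<sigma>"
  then have "gap \<sigma> u + gap \<tau> u \<le> 2 * 0" using assms by (intro layer_exchange) auto
  then show False using assms by (auto simp: layer_def)
qed

lemma layer_unique:
  assumes "finite (supp u)" "layer u k \<sigma>" "layer u k \<tau>"
  shows "\<sigma> = \<tau>"
  using layer_chain[OF assms] layer_chain[OF assms(1,3,2)] by auto

lemma weight_perturb: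
  assumes "finite (supp u)" "finite (supp v)" "finite \<sigma>" "\<sigma> \<noteq> {}" "\<And>i. \<bar>u i - v i\<bar> \<le> \<delta>"
  shows "\<bar>weight \<sigma> u - weight \<sigma> v\<bar> \<le> 2 * \<delta>"
proof -
  have "0 \<le> \<delta>" using assms(5)[of undefined] by linarith
  then show ?thesis
    using gap_perturb[OF assms] gap_perturb[of v u \<sigma> \<delta>] assms
    by (auto simp: weight_def abs_minus_commute)
qed

lemma weight_bounds: "0 \<le> weight \<sigma> u" "weight \<sigma> u \<le> 1"
  by (auto simp: weight_def)

text \<open>
  If \<open>m\<close> positive weights left no interval \<open>(q, q + 1)\<close> with \<open>q < m\<close> free, there would be
  one in each of these intervals and, in addition, the weight that is at least \<open>m\<close>. The weights above a
  free interval form the required set.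
\<close>

lemma ex_layer_of_large_gap:
  assumes nn: "\<And>i. 0 \<le> u i" and fin: "finite (supp u)" and big: "supp u \<noteq> {}" "real (card (supp u)) \<le> u i"
  shows "\<exists>\<sigma> k. layer u k \<sigma> \<and> k \<le> card (supp u) \<and> 1 \<le> gap \<sigma> u"
proof -
  let ?m = "card (supp u)"
  define A where "A q = {i. real q + 1 \<le> u i}" for q
  define B where "B q = {i. real q < u i}" for q
  have sub: "A q \<subseteq> B q" "B q \<subseteq> supp u" "B (Suc q) \<subseteq> A q" for q
    by (auto simp: A_def B_def supp_def)
  have finB: "finite (B q)" for q using sub(2) fin finite_subset by blast
  have m: "?m > 0" using fin big by (simp add: card_gt_0_iff)
  have "\<exists>q<?m. A q = B q"
  proof (rule ccontr)
    assume "\<not> ?thesis"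
    then have ne: "A q \<subset> B q" if "q < ?m" for q using sub(1) that by blast
    have "card (A q) + Suc q \<le> ?m" if "q < ?m" for q using that
    proof (induction q)
      case 0
      have "card (A 0) < card (B 0)" using ne[OF 0] finB psubset_card_mono by blast
      moreover have "card (B 0) \<le> ?m" using sub(2) fin card_mono by blast
      ultimately show ?case by simp
    next
      case (Suc q)
      have "card (A (Suc q)) < card (B (Suc q))" using ne[OF Suc.prems] finB psubset_card_mono by blast
      moreover have "card (B (Suc q)) \<le> card (A q)"
        using sub finB by (meson card_mono finite_subset)
      ultimately show ?case using Suc by simp
    qed
    from this[of "?m - 1"] have "card (A (?m - 1)) = 0" using m by simp
    moreover have "finite (A (?m - 1))" using sub(1) finB finite_subset by blast
    moreover have "i \<in> A (?m - 1)" using big m by (simp add: A_def of_nat_diff)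
    ultimately show False by auto
  qed
  then obtain q where q: "q < ?m" "A q = B q" by blast
  have fA: "finite (A q)" using q finB by simp
  have iA: "i \<in> A q" using big q(1) by (simp add: A_def)
  have "1 \<le> gap (A q) u"
  proof (subst le_gap_iff[OF fin fA])
    show "A q \<noteq> {}" using iA by blast
    show "\<forall>i\<in>A q. 1 \<le> u i \<and> (\<forall>j\<in>- A q. u j + 1 \<le> u i)"
      using q(2) unfolding A_def B_def by force

  qed
  moreover have "card (A q) \<le> ?m" using sub fin by (meson card_mono order_trans)
  ultimately have "layer u (card (A q)) (A q)" using fA iA by (auto simp: layer_def)
  then show ?thesis using \<open>1 \<le> gap (A q) u\<close> \<open>card (A q) \<le> ?m\<close> by blast
qed

section \<open>Contractions along the chain\<close>

text \<open>
  There is at most one set of cardinality \<open>k\<close> with positive gap, so stages can be numbered by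
  cardinality. Stages without such a set do nothing; therefore one number of stages serves all
  vectors whose supports lie in a given finite set.
\<close>

definition contract_layer ::
    "('i set \<Rightarrow> 'z \<times> real \<Rightarrow> 'z) \<Rightarrow> ('i \<Rightarrow> real) \<Rightarrow> real \<Rightarrow> nat \<Rightarrow> 'z \<Rightarrow> 'z" where
  "contract_layer F u s k y =
     (if \<exists>\<sigma>. layer u k \<sigma> then (let \<sigma> = THE \<sigma>. layer u k \<sigma> in F \<sigma> (y, s * weight \<sigma> u)) else y)"

primrec contract_layers ::
    "('i set \<Rightarrow> 'z \<times> real \<Rightarrow> 'z) \<Rightarrow> ('i \<Rightarrow> real) \<Rightarrow> real \<Rightarrow> nat \<Rightarrow> 'z \<Rightarrow> 'z" where
  "contract_layers F u s 0 y = y"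
| "contract_layers F u s (Suc n) y = contract_layers F u s n (contract_layer F u s (Suc n) y)"

lemma contract_layer_eq:
  assumes "finite (supp u)" "layer u k \<sigma>"
  shows "contract_layer F u s k y = F \<sigma> (y, s * weight \<sigma> u)"
proof -
  have "(THE \<sigma>. layer u k \<sigma>) = \<sigma>"
    using assms(2) layer_unique[OF assms(1) _ assms(2)]
    by (rule the_equality[where P = "layer u k"])
  moreover have "\<exists>\<sigma>. layer u k \<sigma>" using assms by blast
  ultimately show ?thesis by (simp only: contract_layer_def if_True Let_def)
qed

lemma contract_layer_trivial:
  "(\<And>\<sigma>. \<not> layer u k \<sigma>) \<Longrightarrow> contract_layer F u s k y = y"
  by (simp add: contract_layer_def)

lemma contract_layers_extend:
  assumes "finite (supp u)" "card (supp u) \<le> n"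
  shows "contract_layers F u s n y = contract_layers F u s (card (supp u)) y"
  using assms(2)
proof (induction n rule: dec_induct)
  case (step n)
  have "\<not> layer u (Suc n) \<sigma>" for \<sigma>
  proof
    assume l: "layer u (Suc n) \<sigma>"
    then have "card \<sigma> \<le> card (supp u)" using layer_subset_supp assms(1) card_mono by metis
    then show False using l step by (auto simp: layer_def)
  qed
  then show ?case using step by (simp add: contract_layer_trivial)
qed simp

lemma dist_Pair_le_add: "dist (y, s) (y', s') \<le> dist y y' + \<bar>s - s'\<bar>" for s s' :: real
  using sqrt_sum_squares_le_sum_abs[of "dist y y'" "s - s'"] by (simp add: dist_Pair_Pair dist_real_def)

text \<open>
  For the good covering, \<open>D \<sigma>\<close> is the intersection of the members of \<open>\<sigma>\<close>; in the target
  space \<open>Y\<close>, it is a ball whose radius depends on the cardinality of \<open>\<sigma>\<close>. Only strict inclusions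
  \<open>\<tau> \<subset> \<sigma>\<close> occur in the last axiom, because a contraction in \<open>Y\<close> does not preserve its own domain.
\<close>

locale nerve_contractions =
  fixes N :: "'i set set" and D :: "'i set \<Rightarrow> 'z::metric_space set"
    and F :: "'i set \<Rightarrow> 'z \<times> real \<Rightarrow> 'z"
  assumes simplexD: "\<sigma> \<in> N \<Longrightarrow> finite \<sigma>" "\<sigma> \<in> N \<Longrightarrow> \<sigma> \<noteq> {}"
    and Lipschitz: "\<sigma> \<in> N \<Longrightarrow> \<exists>L. L-lipschitz_on (D \<sigma> \<times> {0..1}) (F \<sigma>)"
    and at_0: "\<sigma> \<in> N \<Longrightarrow> y \<in> D \<sigma> \<Longrightarrow> F \<sigma> (y, 0) = y"
    and at_1: "\<sigma> \<in> N \<Longrightarrow> y \<in> D \<sigma> \<Longrightarrow> z \<in> D \<sigma> \<Longrightarrow> F \<sigma> (y, 1) = F \<sigma> (z, 1)"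
    and nested: "\<sigma> \<in> N \<Longrightarrow> \<tau> \<in> N \<Longrightarrow> \<tau> \<subset> \<sigma> \<Longrightarrow> y \<in> D \<sigma> \<Longrightarrow> s \<in> {0..1} \<Longrightarrow> F \<sigma> (y, s) \<in> D \<tau>"
begin

definition weights_on :: "'i set \<Rightarrow> ('i \<Rightarrow> real) \<Rightarrow> bool" where
  "weights_on A u \<longleftrightarrow> finite A \<and> supp u \<subseteq> A \<and> (\<forall>i. 0 \<le> u i) \<and> (\<forall>\<sigma>. \<sigma> \<noteq> {} \<and> \<sigma> \<subseteq> supp u \<longrightarrow> \<sigma> \<in> N)"

text \<open>
  The invariant of the composition: before the stages \<open>k, \<dots>, 1\<close> are run, the point lies in the
  domains of all contractions that are still to be applied.
\<close>

definition ready :: "('i \<Rightarrow> real) \<Rightarrow> nat \<Rightarrow> 'z \<Rightarrow> bool" where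
  "ready u k y \<longleftrightarrow> (\<forall>j \<sigma>. j \<le> k \<and> layer u j \<sigma> \<longrightarrow> y \<in> D \<sigma>)"

lemma weights_onD:
  assumes "weights_on A u"
  shows "finite (supp u)" "layer u k \<sigma> \<Longrightarrow> \<sigma> \<in> N" "layer u k \<sigma> \<Longrightarrow> \<sigma> \<subseteq> A"
proof -
  show f: "finite (supp u)" using assms finite_subset by (auto simp: weights_on_def)
  show "layer u k \<sigma> \<Longrightarrow> \<sigma> \<in> N" "layer u k \<sigma> \<Longrightarrow> \<sigma> \<subseteq> A"
    using layer_subset_supp[OF f] assms by (auto simp: weights_on_def layer_def)
qed

lemma uniform_Lipschitz:
  assumes "finite A"
  shows "\<exists>L\<ge>1. \<forall>\<sigma>\<in>N. \<sigma> \<subseteq> A \<longrightarrow> L-lipschitz_on (D \<sigma> \<times> {0..1}) (F \<sigma>)"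
proof -
  obtain l where l: "\<And>\<sigma>. \<sigma> \<in> N \<Longrightarrow> (l \<sigma>)-lipschitz_on (D \<sigma> \<times> {0..1}) (F \<sigma>)"
    using Lipschitz by metis
  define L where "L = 1 + (\<Sum>\<sigma>\<in>Pow A. \<bar>l \<sigma>\<bar>)"
  have "l \<sigma> \<le> L" if "\<sigma> \<subseteq> A" for \<sigma>
  proof -
    have "\<bar>l \<sigma>\<bar> \<le> (\<Sum>\<sigma>\<in>Pow A. \<bar>l \<sigma>\<bar>)" by (rule member_le_sum) (use that assms in auto)
    then show ?thesis by (simp add: L_def)
  qed
  moreover have "L \<ge> 1" by (simp add: L_def sum_nonneg)
  ultimately show ?thesis using l lipschitz_on_le by blast
qed

lemma contract_layer_ready:
  assumes u: "weights_on A u" and y: "ready u (Suc k) y" and s: "s \<in> {0..1}"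
  shows "ready u k (contract_layer F u s (Suc k) y)"
proof (cases "\<exists>\<sigma>. layer u (Suc k) \<sigma>")
  case True
  then obtain \<sigma> where \<sigma>: "layer u (Suc k) \<sigma>" by blast
  have yD: "y \<in> D \<sigma>" using y \<sigma> by (auto simp: ready_def)
  have w: "s * weight \<sigma> u \<in> {0..1}" using s weight_bounds[of \<sigma> u] by (auto simp: mult_le_one)
  show ?thesis unfolding ready_def contract_layer_eq[OF weights_onD(1)[OF u] \<sigma>]
  proof clarify
    fix j \<tau> assume j: "j \<le> k" "layer u j \<tau>"
    have "\<tau> \<subseteq> \<sigma>" by (rule layer_chain[OF weights_onD(1)[OF u] \<sigma> j(2)]) (use j in simp)
    moreover have "\<tau> \<noteq> \<sigma>" using j \<sigma> by (auto simp: layer_def)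
    ultimately show "F \<sigma> (y, s * weight \<sigma> u) \<in> D \<tau>"
      using nested weights_onD(2)[OF u] \<sigma> j yD w by blast
  qed
next
  case False
  then have "contract_layer F u s (Suc k) y = y" by (simp add: contract_layer_trivial)
  then show ?thesis using y unfolding ready_def by (metis le_SucI)
qed

text \<open>
  If both vectors have the same set at stage \<open>k\<close>, the Lipschitz bound of its contraction
  applies. Otherwise all contractions in question run only for a time proportional to gaps of size
  at most \<open>2 * \<delta>\<close>, by \<open>gap_perturb\<close> and \<open>layer_exchange\<close>, and move their points accordingly
  little.
\<close>

lemma contract_layer_dist:
  assumes u: "weights_on A u" "ready u k y" and v: "weights_on A v" "ready v k z"
    and L: "L \<ge> 1" "\<And>\<sigma>. \<sigma> \<in> N \<Longrightarrow> \<sigma> \<subseteq> A \<Longrightarrow> L-lipschitz_on (D \<sigma> \<times> {0..1}) (F \<sigma>)"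
    and s: "s \<in> {0..1}" "s' \<in> {0..1}" and \<delta>: "\<And>i. \<bar>u i - v i\<bar> \<le> \<delta>"
  shows "dist (contract_layer F u s k y) (contract_layer F v s' k z)
    \<le> L * (dist y z + (2 * \<delta> + \<bar>s - s'\<bar>))"
proof -
  have \<delta>0: "0 \<le> \<delta>" using \<delta>[of undefined] by linarith
  have fu: "finite (supp u)" by (rule weights_onD(1)[OF u(1)])
  have fv: "finite (supp v)" by (rule weights_onD(1)[OF v(1)])
  have w: "s * weight \<sigma> w \<in> {0..1}" if "s \<in> {0..1}" for s \<sigma> and w :: "'i \<Rightarrow> real"
    using that weight_bounds[of \<sigma> w] by (auto simp: mult_le_one)
  have move: "dist (F \<sigma> (a, s * weight \<sigma> w)) a \<le> L * max 0 (gap \<sigma> w)"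
    if "weights_on A w" "layer w k \<sigma>" "ready w k a" "s \<in> {0..1}" for w \<sigma> a s
  proof -
    have a: "a \<in> D \<sigma>" using that by (auto simp: ready_def)
    have N: "\<sigma> \<in> N" "\<sigma> \<subseteq> A" using weights_onD(2,3)[OF that(1,2)] by auto
    have "dist (F \<sigma> (a, s * weight \<sigma> w)) (F \<sigma> (a, 0)) \<le> L * dist (a, s * weight \<sigma> w) (a, 0)"
      by (rule lipschitz_onD[OF L(2)[OF N]]) (use a w[OF that(4)] in auto)
    also have "dist (a, s * weight \<sigma> w) (a, 0) = s * weight \<sigma> w"
      using w[OF that(4), of \<sigma> w] by (simp add: dist_Pair_Pair dist_real_def)
    also have "\<dots> \<le> 1 * max 0 (gap \<sigma> w)"
      using that(4) by (intro mult_mono) (auto simp: weight_def)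
    finally show ?thesis using at_0[OF N(1) a] L(1) by simp
  qed
  have fin: "L * r + dist y z \<le> L * (dist y z + (2 * \<delta> + \<bar>s - s'\<bar>))" if "r \<le> 2 * \<delta>" for r
  proof -
    have "L * r \<le> L * (2 * \<delta> + \<bar>s - s'\<bar>)" using that L(1) by (intro mult_left_mono) auto
    moreover have "1 * dist y z \<le> L * dist y z" using L(1) by (intro mult_right_mono) auto
    ultimately show ?thesis by (simp add: algebra_simps)
  qed
  consider (same) \<sigma> where "layer u k \<sigma>" "layer v k \<sigma>"
    | (diff) \<sigma> \<tau> where "layer u k \<sigma>" "layer v k \<tau>" "\<sigma> \<noteq> \<tau>"
    | (left) \<sigma> where "layer u k \<sigma>" "\<And>\<tau>. \<not> layer v k \<tau>"
    | (right) \<sigma> where "layer v k \<sigma>" "\<And>\<tau>. \<not> layer u k \<tau>"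
    | (none) "\<And>\<tau>. \<not> layer u k \<tau>" "\<And>\<tau>. \<not> layer v k \<tau>" by metis
  then show ?thesis
  proof cases
    case same
    have a: "y \<in> D \<sigma>" "z \<in> D \<sigma>" "\<sigma> \<in> N" "\<sigma> \<subseteq> A"
      using same u(2) v(2) weights_onD(2,3)[OF u(1) same(1)] by (auto simp: ready_def)
    have "dist (F \<sigma> (y, s * weight \<sigma> u)) (F \<sigma> (z, s' * weight \<sigma> v))
        \<le> L * dist (y, s * weight \<sigma> u) (z, s' * weight \<sigma> v)"
      by (rule lipschitz_onD[OF L(2)[OF a(3,4)]]) (use a w[OF s(1)] w[OF s(2)] in auto)
    also have "\<dots> \<le> L * (dist y z + (2 * \<delta> + \<bar>s - s'\<bar>))"
    proof (intro mult_left_mono order_trans[OF dist_Pair_le_add] add_left_mono)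
      have "s * weight \<sigma> u - s' * weight \<sigma> v =
          s * (weight \<sigma> u - weight \<sigma> v) + (s - s') * weight \<sigma> v" by (simp add: algebra_simps)
      also have "\<bar>\<dots>\<bar> \<le> s * \<bar>weight \<sigma> u - weight \<sigma> v\<bar> + \<bar>s - s'\<bar> * weight \<sigma> v"
        using s weight_bounds[of \<sigma> v] by (intro order_trans[OF abs_triangle_ineq]) (auto simp: abs_mult)
      also have "\<dots> \<le> 1 * (2 * \<delta>) + \<bar>s - s'\<bar> * 1"
        using s weight_bounds[of \<sigma> v] weight_perturb[OF fu fv simplexD[OF a(3)] \<delta>]
        by (intro add_mono mult_mono) auto
      finally show "\<bar>s * weight \<sigma> u - s' * weight \<sigma> v\<bar> \<le> 2 * \<delta> + \<bar>s - s'\<bar>" by simp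
    qed (use L in auto)
    finally show ?thesis using same contract_layer_eq fu fv by metis
  next
    case diff
    have c: "\<not> \<tau> \<subseteq> \<sigma>" using diff by (metis card_subset_eq layer_def)
    have g: "gap \<sigma> u + gap \<tau> v \<le> 2 * \<delta>"
      by (rule layer_exchange[OF fu diff(1) fv diff(2) order_refl c \<delta>])
    have p: "gap \<sigma> u > 0" "gap \<tau> v > 0" using diff by (auto simp: layer_def)
    have "dist (F \<sigma> (y, s * weight \<sigma> u)) (F \<tau> (z, s' * weight \<tau> v))
      \<le> dist (F \<sigma> (y, s * weight \<sigma> u)) y + dist y z + dist (F \<tau> (z, s' * weight \<tau> v)) z"
      by metric
    also have "\<dots> \<le> L * (gap \<sigma> u + gap \<tau> v) + dist y z"
      using move[OF u(1) diff(1) u(2) s(1)] move[OF v(1) diff(2) v(2) s(2)] p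
      by (simp add: algebra_simps)
    also note fin[OF g]
    finally show ?thesis using diff contract_layer_eq fu fv by metis
  next
    case left
    have "\<sigma> \<in> N" by (rule weights_onD(2)[OF u(1) left(1)])
    then have g: "gap \<sigma> u \<le> 2 * \<delta>"
      using left gap_perturb[OF fu fv simplexD \<delta>, of \<sigma>] by (fastforce simp: layer_def)
    have "dist (F \<sigma> (y, s * weight \<sigma> u)) z \<le> dist (F \<sigma> (y, s * weight \<sigma> u)) y + dist y z"
      by metric
    also have "\<dots> \<le> L * gap \<sigma> u + dist y z"
      using move[OF u(1) left(1) u(2) s(1)] left by (simp add: layer_def)
    also note fin[OF g]
    finally show ?thesis using left contract_layer_eq contract_layer_trivial fu fv by metis
  next
    case right
    have \<sigma>: "\<sigma> \<in> N" by (rule weights_onD(2)[OF v(1) right(1)])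
    have g: "gap \<sigma> v \<le> 2 * \<delta>"
      using right gap_perturb[OF fv fu simplexD[OF \<sigma>], of \<delta>] simplexD[OF \<sigma>] \<delta>
      by (fastforce simp: layer_def abs_minus_commute)
    have "dist y (F \<sigma> (z, s' * weight \<sigma> v)) \<le> dist (F \<sigma> (z, s' * weight \<sigma> v)) z + dist y z"
      by metric
    also have "\<dots> \<le> L * gap \<sigma> v + dist y z"
      using move[OF v(1) right(1) v(2) s(2)] right by (simp add: layer_def)
    also note fin[OF g]
    finally show ?thesis using right contract_layer_eq contract_layer_trivial fu fv by metis
  next
    case none
    then show ?thesis using fin[of 0] \<delta>0 by (simp add: contract_layer_trivial)
  qed
qed

lemma contract_layers_dist:
  assumes u: "weights_on A u" and v: "weights_on A v"
    and L: "L \<ge> 1" "\<And>\<sigma>. \<sigma> \<in> N \<Longrightarrow> \<sigma> \<subseteq> A \<Longrightarrow> L-lipschitz_on (D \<sigma> \<times> {0..1}) (F \<sigma>)"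
    and s: "s \<in> {0..1}" "s' \<in> {0..1}" and \<delta>: "\<And>i. \<bar>u i - v i\<bar> \<le> \<delta>"
    and yz: "ready u n y" "ready v n z"
  shows "dist (contract_layers F u s n y) (contract_layers F v s' n z)
    \<le> L ^ n * (dist y z + n * (2 * \<delta> + \<bar>s - s'\<bar>))"
  using yz
proof (induction n arbitrary: y z)
  case (Suc n)
  let ?e = "2 * \<delta> + \<bar>s - s'\<bar>"
  let ?y = "contract_layer F u s (Suc n) y" and ?z = "contract_layer F v s' (Suc n) z"
  have e: "0 \<le> ?e" using \<delta>[of undefined] by linarith
  have "dist (contract_layers F u s n ?y) (contract_layers F v s' n ?z)
      \<le> L ^ n * (dist ?y ?z + n * ?e)"
    using contract_layer_ready[OF u Suc.prems(1) s(1)] contract_layer_ready[OF v Suc.prems(2) s(2)]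
    by (rule Suc.IH)
  also have "\<dots> \<le> L ^ n * (L * (dist y z + ?e) + L * (n * ?e))"
  proof (intro mult_left_mono add_mono)
    show "dist ?y ?z \<le> L * (dist y z + ?e)"
      by (rule contract_layer_dist[OF u Suc.prems(1) v Suc.prems(2) L s \<delta>])
    have "1 * (n * ?e) \<le> L * (n * ?e)" using L(1) e by (intro mult_right_mono) auto
    then show "n * ?e \<le> L * (n * ?e)" by simp
  qed (use L in auto)
  also have "\<dots> = L ^ Suc n * (dist y z + Suc n * ?e)" by (simp add: algebra_simps)
  finally show ?case by simp
qed simp

text \<open>
  At the stage whose gap is at least \<open>1\<close>, the first point is sent to the end point of \<open>F \<sigma>\<close>, and
  the second one close to it, whatever the distance of the two points was before. This is where the
  points are forgotten. The condition \<open>\<delta> < 1 / 2\<close> ensures that \<open>\<sigma>\<close> still has a positive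
  gap for \<open>v\<close>.
\<close>

lemma contract_layers_dist_full:
  assumes u: "weights_on A u" and v: "weights_on A v"
    and L: "L \<ge> 1" "\<And>\<sigma>. \<sigma> \<in> N \<Longrightarrow> \<sigma> \<subseteq> A \<Longrightarrow> L-lipschitz_on (D \<sigma> \<times> {0..1}) (F \<sigma>)"
    and \<delta>: "\<And>i. \<bar>u i - v i\<bar> \<le> \<delta>" "\<delta> < 1 / 2"
    and \<sigma>: "layer u k \<sigma>" "1 \<le> gap \<sigma> u" "k \<le> n"
    and yz: "ready u n y" "ready v n z"
  shows "dist (contract_layers F u 1 n y) (contract_layers F v 1 n z) \<le> L ^ n * (n * (2 * \<delta>))"
  using \<sigma>(3) yz
proof (induction n arbitrary: y z)
  case 0
  then show ?case using \<sigma> by (auto simp: layer_def)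
next
  case (Suc n)
  let ?y = "contract_layer F u 1 (Suc n) y" and ?z = "contract_layer F v 1 (Suc n) z"
  have e: "0 \<le> \<delta>" using \<delta>(1)[of undefined] by linarith
  have fu: "finite (supp u)" by (rule weights_onD(1)[OF u])
  have fv: "finite (supp v)" by (rule weights_onD(1)[OF v])
  have r: "ready u n ?y" "ready v n ?z"
    using contract_layer_ready[OF u Suc.prems(2)] contract_layer_ready[OF v Suc.prems(3)] by auto
  show ?case
  proof (cases "k = Suc n")
    case True
    have N: "\<sigma> \<in> N" "\<sigma> \<subseteq> A" using weights_onD(2,3)[OF u \<sigma>(1)] by auto
    have "gap \<sigma> u \<le> gap \<sigma> v + 2 * \<delta>" by (rule gap_perturb[OF fu fv simplexD[OF N(1)] \<delta>(1)])
    then have lv: "layer v k \<sigma>" using \<sigma> \<delta>(2) by (auto simp: layer_def)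
    have D: "y \<in> D \<sigma>" "z \<in> D \<sigma>" using Suc.prems \<sigma>(1) lv by (auto simp: ready_def)
    have wu: "weight \<sigma> u = 1" using \<sigma>(2) by (simp add: weight_def)
    have "dist ?y ?z = dist (F \<sigma> (z, 1)) (F \<sigma> (z, weight \<sigma> v))"
      using contract_layer_eq[OF fu \<sigma>(1), of F 1 y] contract_layer_eq[OF fv lv, of F 1 z] True wu at_1[OF N(1) D] by simp
    also have "\<dots> \<le> L * dist (z, 1::real) (z, weight \<sigma> v)"
      by (rule lipschitz_onD[OF L(2)[OF N]]) (use D weight_bounds[of \<sigma> v] in auto)
    also have "\<dots> \<le> L * (2 * \<delta>)"
      using L(1) weight_perturb[OF fu fv simplexD[OF N(1)] \<delta>(1)] wu
      by (intro mult_left_mono) (auto simp: dist_Pair_Pair dist_real_def)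
    finally have yz: "dist ?y ?z \<le> L * (2 * \<delta>)" .
    have "dist (contract_layers F u 1 n ?y) (contract_layers F v 1 n ?z)
      \<le> L ^ n * (dist ?y ?z + n * (2 * \<delta> + \<bar>1 - 1\<bar>))"
      by (rule contract_layers_dist[OF u v L _ _ \<delta>(1) r]) auto
    also have "\<dots> \<le> L ^ n * (L * (2 * \<delta>) + L * (n * (2 * \<delta>)))"
    proof (intro mult_left_mono add_mono yz)
      have "1 * (n * (2 * \<delta>)) \<le> L * (n * (2 * \<delta>))" using L(1) e by (intro mult_right_mono) auto
      then show "n * (2 * \<delta> + \<bar>1 - 1\<bar>) \<le> L * (n * (2 * \<delta>))" by simp
    qed (use L in auto)
    also have "\<dots> = L ^ Suc n * (Suc n * (2 * \<delta>))" by (simp add: algebra_simps)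
    finally show ?thesis by simp
  next
    case False
    then have "dist (contract_layers F u 1 n ?y) (contract_layers F v 1 n ?z) \<le> L ^ n * (n * (2 * \<delta>))"
      using Suc.prems r by (intro Suc.IH) auto
    also have "\<dots> \<le> L ^ Suc n * (Suc n * (2 * \<delta>))"
      using L(1) e by (intro mult_mono power_increasing) auto
    finally show ?thesis by simp
  qed
qed

lemma contract_layers_at_0:
  assumes u: "weights_on A u" and y: "ready u n y"
  shows "contract_layers F u 0 n y = y"
  using y
proof (induction n)
  case (Suc n)
  have "contract_layer F u 0 (Suc n) y = y"
  proof (cases "\<exists>\<sigma>. layer u (Suc n) \<sigma>")
    case True
    then obtain \<sigma> where \<sigma>: "layer u (Suc n) \<sigma>" by blast
    have "y \<in> D \<sigma>" using Suc.prems \<sigma> by (auto simp: ready_def)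
    then have "F \<sigma> (y, 0) = y" using at_0 weights_onD(2)[OF u \<sigma>] by blast
    then show ?thesis using contract_layer_eq[OF weights_onD(1)[OF u] \<sigma>, of F 0 y] by simp
  qed (simp add: contract_layer_trivial)
  moreover have "ready u n y" using Suc.prems unfolding ready_def by (metis le_SucI)
  ultimately show ?case using Suc.IH by simp
qed simp

lemma contract_layers_mem:
  assumes u: "weights_on A u" and s: "s \<in> {0..1}"
    and E: "\<And>\<sigma> z r. \<sigma> \<in> N \<Longrightarrow> \<sigma> \<subseteq> supp u \<Longrightarrow> z \<in> D \<sigma> \<Longrightarrow> r \<in> {0..1} \<Longrightarrow> F \<sigma> (z, r) \<in> E"
    and y: "ready u n y" "y \<in> E"
  shows "contract_layers F u s n y \<in> E"
  using y
proof (induction n arbitrary: y)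
  case (Suc n)
  have "contract_layer F u s (Suc n) y \<in> E"
  proof (cases "\<exists>\<sigma>. layer u (Suc n) \<sigma>")
    case True
    then obtain \<sigma> where \<sigma>: "layer u (Suc n) \<sigma>" by blast
    have "s * weight \<sigma> u \<in> {0..1}" using s weight_bounds[of \<sigma> u] by (auto simp: mult_le_one)
    moreover have "\<sigma> \<subseteq> supp u" by (rule layer_subset_supp[OF weights_onD(1)[OF u] \<sigma>])
    moreover have "y \<in> D \<sigma>" using Suc.prems \<sigma> by (auto simp: ready_def)
    ultimately have "F \<sigma> (y, s * weight \<sigma> u) \<in> E"
      using E weights_onD(2)[OF u \<sigma>] by blast
    then show ?thesis using contract_layer_eq[OF weights_onD(1)[OF u] \<sigma>] by metis
  qed (use Suc.prems in \<open>simp add: contract_layer_trivial\<close>)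
  then show ?case using Suc.IH contract_layer_ready[OF u Suc.prems(1) s] by simp
qed simp

end

section \<open>Homotopies controlled by weights\<close>

definition nerve :: "'p set \<Rightarrow> ('p \<Rightarrow> 'i \<Rightarrow> real) \<Rightarrow> 'i set set" where
  "nerve P t = {\<sigma>. \<sigma> \<noteq> {} \<and> (\<exists>x\<in>P. \<sigma> \<subseteq> supp (t x))}"

text \<open>
  The third axiom is the condition of \<open>ex_layer_of_large_gap\<close>; partitions of unity, normalised to
  sum \<open>1\<close>, violate it wherever two weights are positive.
\<close>

locale weighted_nerve =
  fixes P :: "'p::metric_space set" and t :: "'p \<Rightarrow> 'i \<Rightarrow> real"
  assumes weights_nonneg: "x \<in> P \<Longrightarrow> 0 \<le> t x i"
    and finite_supp: "x \<in> P \<Longrightarrow> finite (supp (t x))"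
    and dominant: "x \<in> P \<Longrightarrow> \<exists>i\<in>supp (t x). real (card (supp (t x))) \<le> t x i"
    and weights_Lipschitz: "\<exists>L. L-lipschitz_on P (\<lambda>x. t x i)"
    and locally_finite_supp: "x \<in> P \<Longrightarrow> \<exists>r>0. \<exists>A. finite A \<and> (\<forall>z\<in>P \<inter> ball x r. supp (t z) \<subseteq> A)"
begin

lemma locally_uniform_weights:
  assumes "x \<in> P"
  obtains r A K where "r > 0" "finite A" "0 \<le> K" "\<And>z. z \<in> P \<inter> ball x r \<Longrightarrow> supp (t z) \<subseteq> A"
    "\<And>z w i. z \<in> P \<inter> ball x r \<Longrightarrow> w \<in> P \<inter> ball x r \<Longrightarrow> \<bar>t z i - t w i\<bar> \<le> K * dist z w"
proof -
  obtain r A where r: "r > 0" "finite A" "\<And>z. z \<in> P \<inter> ball x r \<Longrightarrow> supp (t z) \<subseteq> A"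
    using locally_finite_supp[OF assms] by blast
  obtain l where l: "\<And>i. (l i)-lipschitz_on P (\<lambda>x. t x i)" using weights_Lipschitz by metis
  define K where "K = (\<Sum>i\<in>A. l i)"
  have l0: "0 \<le> l i" for i using l lipschitz_on_nonneg by blast
  have "\<bar>t z i - t w i\<bar> \<le> K * dist z w" if "z \<in> P \<inter> ball x r" "w \<in> P \<inter> ball x r" for z w i
  proof (cases "i \<in> A")
    case True
    have "\<bar>t z i - t w i\<bar> \<le> l i * dist z w"
      using lipschitz_onD[OF l, of z w i] that by (simp add: dist_real_def)
    also have "l i \<le> K" unfolding K_def using True r(2) l0 by (intro member_le_sum) auto
    finally show ?thesis by (simp add: mult_right_mono)
  next
    case False
    then have "t z i = 0" "t w i = 0" using r(3) that by (auto simp: supp_def)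
    then show ?thesis using l0 by (simp add: K_def sum_nonneg)
  qed
  moreover have "0 \<le> K" using l0 by (simp add: K_def sum_nonneg)
  ultimately show thesis using that[OF r(1,2)] r(3) by blast
qed

end

locale nerve_homotopy = weighted_nerve P t + nerve_contractions "nerve P t" D F
  for P :: "'p::metric_space set" and t :: "'p \<Rightarrow> 'i \<Rightarrow> real"
    and D :: "'i set \<Rightarrow> 'z::metric_space set" and F :: "'i set \<Rightarrow> 'z \<times> real \<Rightarrow> 'z" +
  fixes h :: "'p \<Rightarrow> 'z"
  assumes start: "x \<in> P \<Longrightarrow> \<sigma> \<noteq> {} \<Longrightarrow> \<sigma> \<subseteq> supp (t x) \<Longrightarrow> h x \<in> D \<sigma>"
begin

definition homotopy :: "'p \<times> real \<Rightarrow> 'z" where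
  "homotopy = (\<lambda>(x, s). contract_layers F (t x) s (card (supp (t x))) (h x))"

lemma weights_on_point:
  assumes "x \<in> P" "finite A" "supp (t x) \<subseteq> A"
  shows "weights_on A (t x)"
  unfolding weights_on_def using assms weights_nonneg[OF assms(1)]
  by (auto simp: nerve_def)

lemma ready_start:
  assumes "x \<in> P"
  shows "ready (t x) k (h x)"
  unfolding ready_def
proof clarify
  fix j \<sigma> assume l: "layer (t x) j \<sigma>"
  show "h x \<in> D \<sigma>"
    using start[OF assms] l layer_subset_supp[OF finite_supp[OF assms] l] by (simp add: layer_def)
qed

lemma homotopy_eq:
  assumes "x \<in> P" "finite A" "supp (t x) \<subseteq> A"
  shows "homotopy (x, s) = contract_layers F (t x) s (card A) (h x)"
  using contract_layers_extend[OF finite_supp[OF assms(1)] card_mono[OF assms(2,3)], of F s "h x"]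
  by (simp add: homotopy_def)

lemma homotopy_at_0:
  assumes "x \<in> P"
  shows "homotopy (x, 0) = h x"
  unfolding homotopy_def prod.case
  by (rule contract_layers_at_0[OF weights_on_point[OF assms finite_supp[OF assms] order_refl]
        ready_start[OF assms]])

lemma homotopy_mem:
  assumes "x \<in> P" "s \<in> {0..1}" "h x \<in> E"
    and "\<And>\<sigma> y r. \<sigma> \<in> nerve P t \<Longrightarrow> \<sigma> \<subseteq> supp (t x) \<Longrightarrow> y \<in> D \<sigma> \<Longrightarrow> r \<in> {0..1} \<Longrightarrow> F \<sigma> (y, r) \<in> E"
  shows "homotopy (x, s) \<in> E"
  unfolding homotopy_def prod.case
  by (rule contract_layers_mem[OF weights_on_point[OF assms(1) finite_supp[OF assms(1)] order_refl]
        assms(2,4) ready_start[OF assms(1)] assms(3)])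

text \<open>
  This bound and the following one concern all points whose weights are supported in \<open>A\<close>, however
  far apart the points are. For the second one this is essential: it expresses that
  \<open>homotopy (x, 1)\<close> depends on the weights of \<open>x\<close> only.
\<close>

definition homotopy_bound :: "'i set \<Rightarrow> real \<Rightarrow> bool" where
  "homotopy_bound A C \<longleftrightarrow> (\<forall>x\<in>P. \<forall>z\<in>P. \<forall>s\<in>{0..1}. \<forall>s'\<in>{0..1}. \<forall>\<delta>.
     supp (t x) \<subseteq> A \<longrightarrow> supp (t z) \<subseteq> A \<longrightarrow> (\<forall>i. \<bar>t x i - t z i\<bar> \<le> \<delta>) \<longrightarrow>
     dist (homotopy (x, s)) (homotopy (z, s')) \<le> C * (dist (h x) (h z) + \<delta> + \<bar>s - s'\<bar>))"

definition end_bound :: "'i set \<Rightarrow> real \<Rightarrow> bool" where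
  "end_bound A C \<longleftrightarrow> (\<forall>x\<in>P. \<forall>z\<in>P. \<forall>\<delta><1/2.
     supp (t x) \<subseteq> A \<longrightarrow> supp (t z) \<subseteq> A \<longrightarrow> (\<forall>i. \<bar>t x i - t z i\<bar> \<le> \<delta>) \<longrightarrow>
     dist (homotopy (x, 1)) (homotopy (z, 1)) \<le> C * \<delta>)"

lemma ex_homotopy_bound:
  assumes "finite A"
  shows "\<exists>C\<ge>0. homotopy_bound A C"
proof -
  obtain L where L: "L \<ge> 1" "\<And>\<sigma>. \<sigma> \<in> nerve P t \<Longrightarrow> \<sigma> \<subseteq> A \<Longrightarrow> L-lipschitz_on (D \<sigma> \<times> {0..1}) (F \<sigma>)"
    using uniform_Lipschitz[OF assms] by blast
  let ?n = "card A" let ?C = "L ^ ?n * (1 + 2 * ?n)"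
  have "dist (homotopy (x, s)) (homotopy (z, s')) \<le> ?C * (dist (h x) (h z) + \<delta> + \<bar>s - s'\<bar>)"
    if x: "x \<in> P" "supp (t x) \<subseteq> A" and z: "z \<in> P" "supp (t z) \<subseteq> A"
      and s: "s \<in> {0..1}" "s' \<in> {0..1}" and \<delta>: "\<And>i. \<bar>t x i - t z i\<bar> \<le> \<delta>" for x z s s' \<delta>
  proof -
    have \<delta>0: "0 \<le> \<delta>" using \<delta>[of undefined] by linarith
    have "dist (homotopy (x, s)) (homotopy (z, s'))
        \<le> L ^ ?n * (dist (h x) (h z) + ?n * (2 * \<delta> + \<bar>s - s'\<bar>))"
      unfolding homotopy_eq[OF x(1) assms x(2)] homotopy_eq[OF z(1) assms z(2)]
      by (rule contract_layers_dist[OF weights_on_point[OF x(1) assms x(2)]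
            weights_on_point[OF z(1) assms z(2)] L s \<delta> ready_start[OF x(1)] ready_start[OF z(1)]])
    also have "\<dots> \<le> L ^ ?n * ((1 + 2 * ?n) * (dist (h x) (h z) + \<delta> + \<bar>s - s'\<bar>))"
    proof (intro mult_left_mono)
      have "?n * (2 * \<delta> + \<bar>s - s'\<bar>) \<le> ?n * (2 * (dist (h x) (h z) + \<delta> + \<bar>s - s'\<bar>))"
        by (intro mult_left_mono) auto
      then show "dist (h x) (h z) + ?n * (2 * \<delta> + \<bar>s - s'\<bar>)
          \<le> (1 + 2 * ?n) * (dist (h x) (h z) + \<delta> + \<bar>s - s'\<bar>)"
        using \<delta>0 by (simp add: algebra_simps)
    qed (use L in auto)
    finally show ?thesis by (simp add: mult.assoc)
  qed
  moreover have "0 \<le> ?C" using L(1) by simp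
  ultimately show ?thesis unfolding homotopy_bound_def by (intro exI[of _ ?C]) blast
qed

lemma ex_end_bound:
  assumes "finite A"
  shows "\<exists>C\<ge>0. end_bound A C"
proof -
  obtain L where L: "L \<ge> 1" "\<And>\<sigma>. \<sigma> \<in> nerve P t \<Longrightarrow> \<sigma> \<subseteq> A \<Longrightarrow> L-lipschitz_on (D \<sigma> \<times> {0..1}) (F \<sigma>)"
    using uniform_Lipschitz[OF assms] by blast
  let ?n = "card A" let ?C = "L ^ ?n * (2 * ?n)"
  have "dist (homotopy (x, 1)) (homotopy (z, 1)) \<le> ?C * \<delta>"
    if x: "x \<in> P" "supp (t x) \<subseteq> A" and z: "z \<in> P" "supp (t z) \<subseteq> A"
      and \<delta>: "\<And>i. \<bar>t x i - t z i\<bar> \<le> \<delta>" "\<delta> < 1/2" for x z \<delta>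
  proof -
    obtain i where "i \<in> supp (t x)" "real (card (supp (t x))) \<le> t x i" using dominant[OF x(1)] by blast
    then obtain \<sigma> k where \<sigma>: "layer (t x) k \<sigma>" "k \<le> card (supp (t x))" "1 \<le> gap \<sigma> (t x)"
      using ex_layer_of_large_gap[OF weights_nonneg[OF x(1)] finite_supp[OF x(1)]] by blast
    have k: "k \<le> ?n" using \<sigma>(2) card_mono[OF assms x(2)] by simp
    have "dist (homotopy (x, 1)) (homotopy (z, 1)) \<le> L ^ ?n * (?n * (2 * \<delta>))"
      unfolding homotopy_eq[OF x(1) assms x(2)] homotopy_eq[OF z(1) assms z(2)]
      by (rule contract_layers_dist_full[OF weights_on_point[OF x(1) assms x(2)]
            weights_on_point[OF z(1) assms z(2)] L \<delta> \<sigma>(1,3) k ready_start[OF x(1)] ready_start[OF z(1)]])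
    then show ?thesis by (simp add: algebra_simps)
  qed
  moreover have "0 \<le> ?C" using L(1) by simp
  ultimately show ?thesis unfolding end_bound_def by (intro exI[of _ ?C]) blast
qed

lemma homotopy_continuous_on:
  assumes "continuous_on P h"
  shows "continuous_on (P \<times> {0..1}) homotopy"
  unfolding continuous_on_def
proof
  fix p assume p: "p \<in> P \<times> {0..1::real}"
  obtain x s where xs: "p = (x, s)" "x \<in> P" "s \<in> {0..1}" using p by auto
  obtain r A K where r: "r > 0" "finite A" "0 \<le> K" "\<And>z. z \<in> P \<inter> ball x r \<Longrightarrow> supp (t z) \<subseteq> A"
    "\<And>z w i. z \<in> P \<inter> ball x r \<Longrightarrow> w \<in> P \<inter> ball x r \<Longrightarrow> \<bar>t z i - t w i\<bar> \<le> K * dist z w"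
    by (rule locally_uniform_weights[OF xs(2)]) (rule that)
  obtain C where C: "C \<ge> 0" "homotopy_bound A C"
    using ex_homotopy_bound[OF r(2)] by blast
  let ?F = "at p within P \<times> {0..1}"
  let ?g = "\<lambda>q. C * (dist (h (fst q)) (h x) + K * dist (fst q) x + \<bar>snd q - s\<bar>)"
  have "continuous_on (P \<times> {0..1}) (\<lambda>q. h (fst q))"
    by (rule continuous_on_compose2[OF assms]) (auto intro: continuous_intros)
  then have "((\<lambda>q. h (fst q)) \<longlongrightarrow> h x) ?F"
    using p xs unfolding continuous_on_def by (metis fst_conv)
  then have "(?g \<longlongrightarrow> C * (dist (h x) (h x) + K * dist (fst p) x + \<bar>snd p - s\<bar>)) ?F"
    by (intro tendsto_intros)
  then have g: "(?g \<longlongrightarrow> 0) ?F" using xs by simp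
  have "\<forall>\<^sub>F q in ?F. q \<in> fst -` ball x r"
    by (rule topological_tendstoD[of fst x, simplified vimage_eq[symmetric]])
      (use r xs in \<open>auto intro!: tendsto_eq_intros\<close>)
  moreover have "\<forall>\<^sub>F q in ?F. q \<in> P \<times> {0..1}" by (simp add: eventually_at_filter)
  ultimately have "\<forall>\<^sub>F q in ?F. norm (dist (homotopy q) (homotopy p)) \<le> ?g q"
  proof eventually_elim
    case (elim q)
    obtain z s' where q: "q = (z, s')" by (cases q)
    have z: "z \<in> P \<inter> ball x r" "x \<in> P \<inter> ball x r" using elim q xs r by auto
    have "dist (homotopy (z, s')) (homotopy (x, s)) \<le> C * (dist (h z) (h x) + K * dist z x + \<bar>s' - s\<bar>)"
      by (rule C(2)[unfolded homotopy_bound_def, rule_format]) (use z elim q xs r(4) r(5)[OF z] in auto)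
    then show ?case using q xs by simp
  qed
  then have "((\<lambda>q. dist (homotopy q) (homotopy p)) \<longlongrightarrow> 0) ?F"
    by (rule Lim_null_comparison[OF _ g])
  then show "(homotopy \<longlongrightarrow> homotopy p) ?F" by (simp add: tendsto_dist_iff[symmetric])
qed

lemma homotopy_locally_Lipschitz_map:
  assumes S: "S \<subseteq> P" and h: "locally_Lipschitz_map S Z h"
    and Z: "homotopy \<in> S \<times> {0..1} \<rightarrow> Z"
  shows "locally_Lipschitz_map (S \<times> {0..1}) Z homotopy"
  unfolding locally_Lipschitz_map_def
proof (intro conjI ballI Z)
  fix p assume p: "p \<in> S \<times> {0..1::real}"
  obtain x s where xs: "p = (x, s)" "x \<in> S" "x \<in> P" "s \<in> {0..1}" using p S by auto
  obtain r A K where r: "r > 0" "finite A" "0 \<le> K" "\<And>z. z \<in> P \<inter> ball x r \<Longrightarrow> supp (t z) \<subseteq> A"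
    "\<And>z w i. z \<in> P \<inter> ball x r \<Longrightarrow> w \<in> P \<inter> ball x r \<Longrightarrow> \<bar>t z i - t w i\<bar> \<le> K * dist z w"
    by (rule locally_uniform_weights[OF xs(3)]) (rule that)
  obtain C where C: "C \<ge> 0" "homotopy_bound A C"
    using ex_homotopy_bound[OF r(2)] by blast
  obtain q M where q: "q > 0" "M-lipschitz_on (S \<inter> ball x q) h"
    using h xs(2) unfolding locally_Lipschitz_map_def by blast
  have M: "0 \<le> M" using q(2) lipschitz_on_nonneg by blast
  have "(C * (M + K + 1))-lipschitz_on (S \<times> {0..1} \<inter> ball p (min r q)) homotopy"
  proof (rule lipschitz_onI)
    fix a b assume ab: "a \<in> S \<times> {0..1} \<inter> ball p (min r q)" "b \<in> S \<times> {0..1} \<inter> ball p (min r q)"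
    obtain z u w v where zw: "a = (z, u)" "b = (w, v)" by (cases a, cases b)
    have "dist x z \<le> dist p a" "dist x w \<le> dist p b"
      using dist_fst_le[of p a] dist_fst_le[of p b] zw xs by auto
    then have z: "z \<in> S" "w \<in> S" "z \<in> P \<inter> ball x r" "w \<in> P \<inter> ball x r" "z \<in> ball x q" "w \<in> ball x q"
      and u: "u \<in> {0..1}" "v \<in> {0..1}"
      using ab zw S by auto
    have d: "dist z w \<le> dist a b" "\<bar>u - v\<bar> \<le> dist a b"
      using dist_fst_le[of a b] dist_snd_le[of a b] zw by (auto simp: dist_real_def)
    have "dist (homotopy a) (homotopy b) \<le> C * (dist (h z) (h w) + K * dist z w + \<bar>u - v\<bar>)"
      unfolding zw
      by (rule C(2)[unfolded homotopy_bound_def, rule_format]) (use z u r(4) r(5)[OF z(3,4)] in auto)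
    also have "\<dots> \<le> C * (M * dist z w + K * dist z w + \<bar>u - v\<bar>)"
      using C(1) lipschitz_onD[OF q(2), of z w] z by (intro mult_left_mono add_mono order_refl) auto
    also have "\<dots> \<le> C * (M * dist a b + K * dist a b + dist a b)"
      using C(1) M r(3) d by (intro mult_left_mono add_mono) auto
    finally show "dist (homotopy a) (homotopy b) \<le> C * (M + K + 1) * dist a b"
      by (simp add: algebra_simps)
  qed (use C(1) M r(3) in simp)
  moreover have "min r q > 0" using r q by simp
  ultimately show "\<exists>r>0. \<exists>L. L-lipschitz_on (S \<times> {0..1} \<inter> ball p r) homotopy" by blast
qed

lemma homotopy_end_locally_Lipschitz_map:
  assumes Z: "(\<lambda>x. homotopy (x, 1)) \<in> P \<rightarrow> Z"
  shows "locally_Lipschitz_map P Z (\<lambda>x. homotopy (x, 1))"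
  unfolding locally_Lipschitz_map_def
proof (intro conjI ballI Z)
  fix x assume x: "x \<in> P"
  obtain r A K where r: "r > 0" "finite A" "0 \<le> K" "\<And>z. z \<in> P \<inter> ball x r \<Longrightarrow> supp (t z) \<subseteq> A"
    "\<And>z w i. z \<in> P \<inter> ball x r \<Longrightarrow> w \<in> P \<inter> ball x r \<Longrightarrow> \<bar>t z i - t w i\<bar> \<le> K * dist z w"
    by (rule locally_uniform_weights[OF x]) (rule that)
  obtain C where C: "C \<ge> 0" "end_bound A C"
    using ex_end_bound[OF r(2)] by blast
  \<comment> \<open>two points of the ball of radius \<open>q\<close> have weights closer than \<open>1 / 2\<close>\<close>
  define q where "q = min r (1 / (8 * (K + 1)))"
  have q: "q > 0" "q \<le> r" "q \<le> 1 / (8 * (K + 1))" using r by (auto simp: q_def)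
  have "(C * K)-lipschitz_on (P \<inter> ball x q) (\<lambda>x. homotopy (x, 1))"
  proof (rule lipschitz_onI)
    fix z w assume zw: "z \<in> P \<inter> ball x q" "w \<in> P \<inter> ball x q"
    have zr: "z \<in> P \<inter> ball x r" "w \<in> P \<inter> ball x r" using zw q by auto
    have "dist z w < 2 * q" using zw dist_triangle2[of z w x] by (auto simp: dist_commute)
    then have "K * dist z w \<le> K * (2 * (1 / (8 * (K + 1))))"
      using q r(3) by (intro mult_left_mono) auto
    also have "\<dots> < 1/2" using r(3) by (simp add: field_simps)
    finally have "K * dist z w < 1/2" .
    then have "dist (homotopy (z, 1)) (homotopy (w, 1)) \<le> C * (K * dist z w)"
      using zr r(4) r(5)[OF zr]
      by (intro C(2)[unfolded end_bound_def, rule_format]) auto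
    then show "dist (homotopy (z, 1)) (homotopy (w, 1)) \<le> C * K * dist z w" by (simp add: mult.assoc)
  qed (use C(1) r(3) in simp)
  then show "\<exists>r>0. \<exists>L. L-lipschitz_on (P \<inter> ball x r) (\<lambda>x. homotopy (x, 1))" using q(1) by blast
qed

end

section \<open>Weights dominating the order of a covering\<close>

definition relatively_compact_cover :: "'p::metric_space set \<Rightarrow> 'p set set \<Rightarrow> bool" where
  "relatively_compact_cover P \<W> \<longleftrightarrow>
     (\<forall>W\<in>\<W>. openin (top_of_set P) W \<and> (\<exists>C. compact C \<and> W \<subseteq> C \<and> C \<subseteq> P)) \<and>
     \<Union>\<W> = P \<and> locally_finite_in (top_of_set P) \<W>"

lemma locally_finite_in_ball:
  fixes P :: "'p::metric_space set"
  assumes "locally_finite_in (top_of_set P) \<W>" "x \<in> P"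
  shows "\<exists>r>0. finite {W\<in>\<W>. W \<inter> ball x r \<noteq> {}}"
proof -
  obtain V where V: "openin (top_of_set P) V" "x \<in> V" "finite {W\<in>\<W>. W \<inter> V \<noteq> {}}"
    using assms unfolding locally_finite_in_def by auto
  have W: "W \<subseteq> P" if "W \<in> \<W>" for W
    using assms(1) that unfolding locally_finite_in_def by auto
  obtain r where r: "r > 0" "ball x r \<inter> P \<subseteq> V"
    using V(1,2) unfolding openin_contains_ball by blast
  have "{W\<in>\<W>. W \<inter> ball x r \<noteq> {}} \<subseteq> {W\<in>\<W>. W \<inter> V \<noteq> {}}"
    using r W by blast
  then show ?thesis using r V(3) finite_subset by blast
qed

lemma finite_meeting_compact:
  fixes P :: "'p::metric_space set"
  assumes lf: "locally_finite_in (top_of_set P) \<W>" and C: "compact C" "C \<subseteq> P"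
  shows "finite {W\<in>\<W>. W \<inter> C \<noteq> {}}"
proof -
  obtain r where r: "\<And>x. x \<in> C \<Longrightarrow> r x > 0 \<and> finite {W\<in>\<W>. W \<inter> ball x (r x) \<noteq> {}}"
    using locally_finite_in_ball[OF lf] C(2) by (metis subsetD)
  have "C \<subseteq> (\<Union>x\<in>C. ball x (r x))" using r by fastforce
  then obtain T where T: "T \<subseteq> C" "finite T" "C \<subseteq> (\<Union>x\<in>T. ball x (r x))"
    using compactE_image[OF C(1), of C "\<lambda>x. ball x (r x)"] by (metis open_ball)
  have "{W\<in>\<W>. W \<inter> C \<noteq> {}} \<subseteq> (\<Union>x\<in>T. {W\<in>\<W>. W \<inter> ball x (r x) \<noteq> {}})"
    using T(3) by blast
  moreover have "finite (\<Union>x\<in>T. {W\<in>\<W>. W \<inter> ball x (r x) \<noteq> {}})" using T r by blast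
  ultimately show ?thesis using finite_subset by blast
qed

lemma finite_neighbours:
  assumes "relatively_compact_cover P \<W>" "W \<in> \<W>"
  shows "finite {V\<in>\<W>. V \<inter> W \<noteq> {}}"
proof -
  obtain C where C: "compact C" "W \<subseteq> C" "C \<subseteq> P"
    using assms unfolding relatively_compact_cover_def by blast
  have "finite {V\<in>\<W>. V \<inter> C \<noteq> {}}"
    using finite_meeting_compact[OF _ C(1,3)] assms unfolding relatively_compact_cover_def by blast
  then show ?thesis by (rule rev_finite_subset) (use C in blast)
qed

text \<open>
  The case distinction replaces the convention that the distance to the empty set is \<open>0\<close>.
\<close>

definition depth :: "'p::metric_space set \<Rightarrow> 'p set \<Rightarrow> 'p \<Rightarrow> real" where
  "depth P W x = (if P \<subseteq> W then 1 else infdist x (P - W))"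

lemma depth_Lipschitz: "1-lipschitz_on S (depth P W)"
  by (rule lipschitz_onI) (auto simp: depth_def dist_real_def infdist_triangle_abs)

lemma depth_nonneg: "0 \<le> depth P W x"
  by (simp add: depth_def infdist_nonneg)

lemma le_depth:
  assumes "e \<le> 1" "ball x e \<inter> P \<subseteq> W"
  shows "e \<le> depth P W x"
proof (cases "P \<subseteq> W")
  case False
  have "e \<le> dist x y" if "y \<in> P - W" for y
    using assms(2) that by (auto simp: subset_iff not_less[symmetric])
  then show ?thesis using False unfolding depth_def infdist_def
    by (auto intro!: cINF_greatest)
qed (use assms in \<open>simp add: depth_def\<close>)

lemma depth_pos_iff:
  assumes "openin (top_of_set P) W" "x \<in> P"
  shows "0 < depth P W x \<longleftrightarrow> x \<in> W"
proof
  assume "x \<in> W"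
  then obtain e where e: "e > 0" "ball x e \<inter> P \<subseteq> W"
    using assms(1) unfolding openin_contains_ball by blast
  have "ball x (min e 1) \<inter> P \<subseteq> W" using e by auto
  then have "min e 1 \<le> depth P W x" by (intro le_depth) auto
  then show "0 < depth P W x" using e by linarith
next
  assume "0 < depth P W x"
  then show "x \<in> W" using assms(2) by (auto simp: depth_def split: if_splits)
qed

text \<open>
  By compactness there is \<open>\<mu> W > 0\<close> such that every point of \<open>W\<close> has depth at least \<open>\<mu> W\<close> in
  some member of the covering (a Lebesgue number). The weight of \<open>W\<close> is its depth, scaled by the
  number of neighbours of \<open>W\<close> over \<open>\<mu> W\<close>. If \<open>W\<close> is a set in which \<open>x\<close> has the greatest depth,
  this depth is at least \<open>\<mu> W\<close>, so that the weight of \<open>W\<close> at \<open>x\<close> is at least the number of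
  neighbours of \<open>W\<close>, and all sets containing \<open>x\<close> are among these.
\<close>

lemma ex_dominant_weights:
  assumes "relatively_compact_cover P \<W>"
  shows "\<exists>t. weighted_nerve P t \<and> (\<forall>x\<in>P. supp (t x) = {W\<in>\<W>. x \<in> W})"
proof -
  have opn: "openin (top_of_set P) W" if "W \<in> \<W>" for W
    using that assms unfolding relatively_compact_cover_def by auto
  have cov: "\<Union>\<W> = P" and lf: "locally_finite_in (top_of_set P) \<W>"
    using assms unfolding relatively_compact_cover_def by auto
  let ?nb = "\<lambda>W. {V\<in>\<W>. V \<inter> W \<noteq> {}}"
  have "\<exists>\<mu>>0. \<forall>x\<in>W. \<exists>V\<in>\<W>. \<mu> \<le> depth P V x" if W: "W \<in> \<W>" for W
  proof -
    obtain C where C: "compact C" "W \<subseteq> C" "C \<subseteq> P"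
      using assms W unfolding relatively_compact_cover_def by blast
    let ?G = "{G. open G \<and> P \<inter> G \<in> \<W>}"
    have "C \<subseteq> \<Union>?G"
    proof
      fix x assume "x \<in> C"
      then obtain V where "V \<in> \<W>" "x \<in> V" using C(3) cov by blast
      then show "x \<in> \<Union>?G" using opn[of V] by (auto simp: openin_open)
    qed
    then obtain e where e: "e > 0" "\<And>x. x \<in> C \<Longrightarrow> \<exists>G\<in>?G. ball x e \<subseteq> G"
      using Heine_Borel_lemma[OF C(1)] by (metis (no_types, lifting) mem_Collect_eq)
    have "\<exists>V\<in>\<W>. min e 1 \<le> depth P V x" if x: "x \<in> W" for x
    proof -
      obtain G where G: "P \<inter> G \<in> \<W>" "ball x e \<subseteq> G" using e(2) x C(2) by blast
      have "min e 1 \<le> depth P (P \<inter> G) x" by (rule le_depth) (use G in auto)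
      then show ?thesis using G by blast
    qed
    then show ?thesis using e(1) by (intro exI[of _ "min e 1"]) auto
  qed
  then obtain \<mu> where \<mu>: "\<And>W. W \<in> \<W> \<Longrightarrow> \<mu> W > 0"
      "\<And>W x. W \<in> \<W> \<Longrightarrow> x \<in> W \<Longrightarrow> \<exists>V\<in>\<W>. \<mu> W \<le> depth P V x"
    by metis
  define t where "t x W = (if W \<in> \<W> then card (?nb W) / \<mu> W * depth P W x else 0)" for x W
  have fin: "finite (?nb W)" if "W \<in> \<W>" for W
    using finite_neighbours[OF assms that] .
  have supp: "supp (t x) = {W\<in>\<W>. x \<in> W}" if x: "x \<in> P" for x
  proof -
    have "t x W \<noteq> 0 \<longleftrightarrow> x \<in> W" if W: "W \<in> \<W>" for W
    proof (cases "x \<in> W")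
      case True
      then have "W \<in> ?nb W" using W by blast
      then have "card (?nb W) > 0" using fin[OF W] card_gt_0_iff by blast
      then show ?thesis using True depth_pos_iff[OF opn[OF W] x] \<mu>(1)[OF W] W by (simp add: t_def)
    next
      case False
      then have "depth P W x = 0"
        using depth_pos_iff[OF opn[OF W] x] depth_nonneg[of P W x] by linarith
      then show ?thesis using False by (simp add: t_def)
    qed
    then show ?thesis by (auto simp: supp_def t_def)
  qed
  have "weighted_nerve P t"
  proof
    fix x and i :: "'a set" assume x: "x \<in> P"
    show "0 \<le> t x i"
      using \<mu>(1)[of i] depth_nonneg[of P i x] by (auto simp: t_def intro!: mult_nonneg_nonneg divide_nonneg_pos)
    obtain r where r: "r > 0" "finite {W\<in>\<W>. W \<inter> ball x r \<noteq> {}}"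
      using locally_finite_in_ball[OF lf x] by blast
    have "supp (t z) \<subseteq> {W\<in>\<W>. W \<inter> ball x r \<noteq> {}}" if "z \<in> P \<inter> ball x r" for z
      using that supp[of z] by auto
    then show *: "\<exists>r>0. \<exists>A. finite A \<and> (\<forall>z\<in>P \<inter> ball x r. supp (t z) \<subseteq> A)"
      using r by blast
    show finx: "finite (supp (t x))"
      using r(2) by (rule rev_finite_subset) (use supp[OF x] r x in auto)
    have ne: "supp (t x) \<noteq> {}" using supp[OF x] cov x by blast
    have "Max ((\<lambda>V. depth P V x) ` supp (t x)) \<in> (\<lambda>V. depth P V x) ` supp (t x)"
      using finx ne by (intro Max_in) auto
    then obtain W where W: "W \<in> supp (t x)" "depth P W x = Max ((\<lambda>V. depth P V x) ` supp (t x))"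
      by auto
    then have Wmax: "depth P V x \<le> depth P W x" if "V \<in> supp (t x)" for V
      using finx that by auto
    have WW: "W \<in> \<W>" "x \<in> W" using W(1) supp[OF x] by auto
    obtain V where V: "V \<in> \<W>" "\<mu> W \<le> depth P V x" using \<mu>(2)[OF WW] by blast
    have "x \<in> V" using depth_pos_iff[OF opn[OF V(1)] x] V(2) \<mu>(1)[OF WW(1)] by linarith
    then have "depth P V x \<le> depth P W x" using Wmax V(1) supp[OF x] by blast
    then have d: "1 \<le> depth P W x / \<mu> W" using V(2) \<mu>(1)[OF WW(1)] by (simp add: field_simps)
    have "supp (t x) \<subseteq> ?nb W" using supp[OF x] WW by blast
    then have "real (card (supp (t x))) \<le> real (card (?nb W)) * 1"
      using card_mono[OF fin[OF WW(1)]] by simp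
    also have "\<dots> \<le> card (?nb W) * (depth P W x / \<mu> W)" using d by (intro mult_left_mono) auto
    also have "\<dots> = t x W" using WW by (simp add: t_def)
    finally show "\<exists>i\<in>supp (t x). real (card (supp (t x))) \<le> t x i" using W(1) by blast
  next
    fix W
    show "\<exists>L. L-lipschitz_on P (\<lambda>x. t x W)"
    proof (cases "W \<in> \<W>")
      case True
      have "(\<bar>card (?nb W) / \<mu> W\<bar> * 1)-lipschitz_on P (\<lambda>x. card (?nb W) / \<mu> W * depth P W x)"
        by (intro lipschitz_on_cmult_real depth_Lipschitz)
      then show ?thesis using True by (auto simp: t_def)
    next
      case False
      then show ?thesis using lipschitz_on_constant[of P "0::real"] by (auto simp: t_def)
    qed
  qed
  then show ?thesis using supp by blast
qed

section \<open>Deforming a space with a good covering\<close>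

lemma good_covering_relatively_compact:
  assumes "good_covering X \<U>"
  shows "relatively_compact_cover X \<U>"
  unfolding relatively_compact_cover_def
proof (intro conjI ballI)
  fix U assume U: "U \<in> \<U>"
  then show "openin (top_of_set X) U" using assms by (auto simp: good_covering_def)
  then have "U \<subseteq> X" by (rule openin_imp_subset)
  then show "\<exists>C. compact C \<and> U \<subseteq> C \<and> C \<subseteq> X"
    using assms U closure_of_subset[of U "top_of_set X"] closure_of_subset_topspace[of "top_of_set X" U]
    by (intro exI[of _ "top_of_set X closure_of U"]) (auto simp: good_covering_def)
qed (use assms in \<open>auto simp: good_covering_def\<close>)

text \<open>
  The estimate in the last clause compares arbitrary points of \<open>U\<close> and involves their weights only:
  it is the substitute for a Lipschitz map from the nerve to \<open>X\<close>. The third clause keeps the image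
  of \<open>U\<close> within finitely many relatively compact sets.
\<close>

lemma good_covering_deformation:
  fixes X :: "'a::metric_space set"
  assumes good: "good_covering X \<U>"
    and t: "weighted_nerve X t" "\<forall>x\<in>X. supp (t x) = {U\<in>\<U>. x \<in> U}"
  shows "\<exists>\<Phi>. locally_Lipschitz_map (X \<times> {0..1::real}) X \<Phi> \<and> (\<forall>x\<in>X. \<Phi> (x, 0) = x) \<and>
    (\<forall>U\<in>\<U>. \<forall>x\<in>U. \<Phi> (x, 1) \<in> \<Union>{V\<in>\<U>. V \<inter> U \<noteq> {}}) \<and>
    (\<forall>U\<in>\<U>. \<exists>C\<ge>0. \<forall>x\<in>U. \<forall>z\<in>U. \<forall>\<delta><1/2. (\<forall>V. \<bar>t x V - t z V\<bar> \<le> \<delta>) \<longrightarrow>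
       dist (\<Phi> (x, 1)) (\<Phi> (z, 1)) \<le> C * \<delta>)"
proof -
  have cov: "relatively_compact_cover X \<U>" by (rule good_covering_relatively_compact[OF good])
  then have UX: "\<Union>\<U> = X" by (simp add: relatively_compact_cover_def)
  interpret weighted_nerve X t by (rule t(1))
  note supp_t = t(2)[rule_format]
  have nerve: "\<sigma> \<subseteq> \<U>" "finite \<sigma>" "\<sigma> \<noteq> {}" "\<Inter>\<sigma> \<noteq> {}" if \<sigma>: "\<sigma> \<in> nerve X t" for \<sigma>
  proof -
    obtain x where x: "x \<in> X" "\<sigma> \<subseteq> supp (t x)" "\<sigma> \<noteq> {}" using \<sigma> by (auto simp: nerve_def)
    show "\<sigma> \<subseteq> \<U>" "\<Inter>\<sigma> \<noteq> {}" "\<sigma> \<noteq> {}" using x supp_t[OF x(1)] by auto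
    show "finite \<sigma>" using finite_supp[OF x(1)] x(2) finite_subset by blast
  qed
  have "\<exists>F p. Lipschitz_strong_deformation_retraction (\<Inter>\<sigma>) {p} F" if "\<sigma> \<in> nerve X t" for \<sigma>
    using good nerve[OF that] unfolding good_covering_def by blast
  then obtain F p where F: "\<And>\<sigma>. \<sigma> \<in> nerve X t \<Longrightarrow> Lipschitz_strong_deformation_retraction (\<Inter>\<sigma>) {p \<sigma>} (F \<sigma>)"
    by metis
  interpret nerve_homotopy X t "\<lambda>\<sigma>. \<Inter>\<sigma>" F "\<lambda>x. x"
  proof
    fix \<sigma> assume \<sigma>: "\<sigma> \<in> nerve X t"
    note F' = F[OF \<sigma>, unfolded Lipschitz_strong_deformation_retraction_def]
    show "finite \<sigma>" "\<sigma> \<noteq> {}" using nerve[OF \<sigma>] by auto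
    show "\<exists>L. L-lipschitz_on (\<Inter>\<sigma> \<times> {0..1}) (F \<sigma>)" using F' by blast
    show "F \<sigma> (y, 0) = y" if "y \<in> \<Inter>\<sigma>" for y using F' that by blast
    show "F \<sigma> (y, 1) = F \<sigma> (z, 1)" if "y \<in> \<Inter>\<sigma>" "z \<in> \<Inter>\<sigma>" for y z
    proof -
      have "F \<sigma> (y, 1) \<in> {p \<sigma>}" "F \<sigma> (z, 1) \<in> {p \<sigma>}" using F' that by blast+
      then show ?thesis by simp
    qed
    show "F \<sigma> (y, s) \<in> \<Inter>\<tau>" if "\<tau> \<subset> \<sigma>" "y \<in> \<Inter>\<sigma>" "s \<in> {0..1}" for \<tau> y s
    proof -
      have "F \<sigma> (y, s) \<in> \<Inter>\<sigma>" using F' that(2,3) by blast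
      then show ?thesis using that(1) by blast
    qed
  next
    fix x \<sigma> assume "x \<in> X" "\<sigma> \<noteq> {}" "\<sigma> \<subseteq> supp (t x)"
    then show "x \<in> \<Inter>\<sigma>" using supp_t by blast
  qed
  have memE: "homotopy (x, s) \<in> \<Union>{V\<in>\<U>. V \<inter> U \<noteq> {}}" if "U \<in> \<U>" "x \<in> U" "s \<in> {0..1}" for x U s
  proof (rule homotopy_mem[OF _ that(3)])
    show x: "x \<in> X" using that UX by blast
    show "x \<in> \<Union>{V\<in>\<U>. V \<inter> U \<noteq> {}}" using that by blast
    fix \<sigma> y r assume \<sigma>: "\<sigma> \<in> nerve X t" "\<sigma> \<subseteq> supp (t x)" "y \<in> \<Inter>\<sigma>" "r \<in> {0..1::real}"
    have "F \<sigma> (y, r) \<in> \<Inter>\<sigma>"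
      using F[OF \<sigma>(1)] \<sigma>(3,4) unfolding Lipschitz_strong_deformation_retraction_def by blast
    moreover obtain V where "V \<in> \<sigma>" using nerve(3)[OF \<sigma>(1)] by blast
    moreover from this have "V \<in> \<U>" "x \<in> V" using \<sigma>(2) supp_t[OF x] by auto
    ultimately show "F \<sigma> (y, r) \<in> \<Union>{V\<in>\<U>. V \<inter> U \<noteq> {}}" using that(2) by blast
  qed
  have mem: "homotopy \<in> X \<times> {0..1} \<rightarrow> X"
  proof (rule funcsetI)
    fix q assume "q \<in> X \<times> {0..1::real}"
    then obtain x s where q: "q = (x, s)" "x \<in> X" "s \<in> {0..1}" by auto
    then obtain U where "U \<in> \<U>" "x \<in> U" using UX by blast
    then show "homotopy q \<in> X" using memE q UX by blast
  qed
  have "1-lipschitz_on X (\<lambda>x. x)" by (rule lipschitz_on_id)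
  then have "locally_Lipschitz_map X X (\<lambda>x. x)" by (rule Lipschitz_imp_locally_Lipschitz_map) simp
  then have "locally_Lipschitz_map (X \<times> {0..1}) X homotopy"
    by (rule homotopy_locally_Lipschitz_map[OF order_refl _ mem])
  moreover have "\<exists>C\<ge>0. \<forall>x\<in>U. \<forall>z\<in>U. \<forall>\<delta><1/2. (\<forall>V. \<bar>t x V - t z V\<bar> \<le> \<delta>) \<longrightarrow>
       dist (homotopy (x, 1)) (homotopy (z, 1)) \<le> C * \<delta>" if U: "U \<in> \<U>" for U
  proof -
    obtain C where C: "C \<ge> 0" "end_bound {V\<in>\<U>. V \<inter> U \<noteq> {}} C"
      using ex_end_bound[OF finite_neighbours[OF cov U]] by blast
    have s: "supp (t x) \<subseteq> {V\<in>\<U>. V \<inter> U \<noteq> {}}" "x \<in> X" if "x \<in> U" for x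
      using that UX U supp_t[of x] by auto
    show ?thesis
      using C(1) C(2)[unfolded end_bound_def] s by (intro exI[of _ C]) blast
  qed
  ultimately show ?thesis
    using memE homotopy_at_0 by (intro exI[of _ homotopy]) auto
qed

section \<open>Contraction radii\<close>

definition Lipschitz_contracts_in :: "'b::metric_space set \<Rightarrow> 'b set \<Rightarrow> 'b set \<Rightarrow> bool" where
  "Lipschitz_contracts_in Y A B \<longleftrightarrow> (\<exists>\<phi>. (\<exists>L. L-lipschitz_on ((Y \<inter> A) \<times> {0..1::real}) \<phi>) \<and>
     \<phi> \<in> (Y \<inter> A) \<times> {0..1} \<rightarrow> Y \<inter> B \<and>
     (\<forall>x\<in>Y \<inter> A. \<phi> (x, 0) = x) \<and> (\<forall>x\<in>Y \<inter> A. \<forall>z\<in>Y \<inter> A. \<phi> (x, 1) = \<phi> (z, 1)))"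

lemma Lipschitz_contracts_in_mono:
  assumes "Lipschitz_contracts_in Y A B" "A' \<subseteq> A" "B \<subseteq> B'"
  shows "Lipschitz_contracts_in Y A' B'"
proof -
  obtain \<phi> L where \<phi>: "L-lipschitz_on ((Y \<inter> A) \<times> {0..1::real}) \<phi>" "\<phi> \<in> (Y \<inter> A) \<times> {0..1} \<rightarrow> Y \<inter> B"
    "\<forall>x\<in>Y \<inter> A. \<phi> (x, 0) = x" "\<forall>x\<in>Y \<inter> A. \<forall>z\<in>Y \<inter> A. \<phi> (x, 1) = \<phi> (z, 1)"
    using assms(1) unfolding Lipschitz_contracts_in_def by blast
  have "L-lipschitz_on ((Y \<inter> A') \<times> {0..1}) \<phi>"
    using \<phi>(1) by (rule lipschitz_on_subset) (use assms in auto)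
  moreover have "\<phi> \<in> (Y \<inter> A') \<times> {0..1} \<rightarrow> Y \<inter> B'" using \<phi>(2) assms by blast
  ultimately show ?thesis unfolding Lipschitz_contracts_in_def using \<phi>(3,4) assms(2) by blast
qed

text \<open>
  Local Lipschitz contractibility provides a radius \<open>R p\<close> at each \<open>p\<close>, without any regularity in
  \<open>p\<close>. A ball about \<open>y\<close> inside the ball of radius \<open>R p\<close> about \<open>p\<close> contracts as well, so the
  supremum of \<open>R p - dist p y\<close> over \<open>p\<close>, which is 1-Lipschitz in \<open>y\<close>, can be used instead.
  It is halved since the supremum need not be attained.
\<close>

lemma contraction_radius:
  fixes Y :: "'b::metric_space set"
  assumes Y: "locally_Lipschitz_contractible Y"
    and \<epsilon>: "\<And>y. y \<in> Y \<Longrightarrow> 0 < \<epsilon> y" "\<And>y z. y \<in> Y \<Longrightarrow> z \<in> Y \<Longrightarrow> \<epsilon> y \<le> \<epsilon> z + dist y z"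
  shows "\<exists>\<rho>. (\<forall>y\<in>Y. 0 < \<rho> y \<and> \<rho> y \<le> \<epsilon> y) \<and> (\<forall>y\<in>Y. \<forall>z\<in>Y. \<rho> y \<le> \<rho> z + dist y z) \<and>
    (\<forall>y\<in>Y. Lipschitz_contracts_in Y (ball y (\<rho> y)) (ball y (\<epsilon> y)))"
proof -
  have "\<exists>r>0. r \<le> \<epsilon> p / 3 \<and> Lipschitz_contracts_in Y (ball p r) (ball p (\<epsilon> p / 3))" if p: "p \<in> Y" for p
  proof -
    have "\<epsilon> p / 3 > 0" using \<epsilon>(1)[OF p] by simp
    then obtain r \<phi> L where r: "0 < r" "r \<le> \<epsilon> p / 3" "L-lipschitz_on ((Y \<inter> ball p r) \<times> {0..1::real}) \<phi>"
        "\<phi> \<in> (Y \<inter> ball p r) \<times> {0..1} \<rightarrow> Y \<inter> ball p (\<epsilon> p / 3)"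
        "\<forall>x\<in>Y \<inter> ball p r. \<phi> (x, 0) = x \<and> \<phi> (x, 1) = p"
      using Y p unfolding locally_Lipschitz_contractible_def by metis
    have "Lipschitz_contracts_in Y (ball p r) (ball p (\<epsilon> p / 3))"
      unfolding Lipschitz_contracts_in_def
      by (intro exI[of _ \<phi>] conjI) (use r(3-5) in auto)
    then show ?thesis using r by blast
  qed
  then obtain R where R: "\<And>p. p \<in> Y \<Longrightarrow> R p > 0" "\<And>p. p \<in> Y \<Longrightarrow> R p \<le> \<epsilon> p / 3"
      "\<And>p. p \<in> Y \<Longrightarrow> Lipschitz_contracts_in Y (ball p (R p)) (ball p (\<epsilon> p / 3))"
    by metis
  define S where "S y = (SUP p\<in>Y. R p - dist p y)" for y
  have le: "R p - dist p y \<le> \<epsilon> y / 3" if "p \<in> Y" "y \<in> Y" for p y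
  proof -
    have "3 * R p \<le> \<epsilon> p" using R(2)[OF that(1)] by simp
    then show ?thesis using \<epsilon>(2)[OF that] zero_le_dist[of p y] by linarith
  qed
  then have bdd: "bdd_above ((\<lambda>p. R p - dist p y) ` Y)" if "y \<in> Y" for y
    using that by (intro bdd_aboveI[of _ "\<epsilon> y / 3"]) auto
  have upper: "R p - dist p y \<le> S y" if "p \<in> Y" "y \<in> Y" for p y
    unfolding S_def using bdd that by (intro cSUP_upper) auto
  have pos: "0 < S y" if "y \<in> Y" for y using upper[OF that that] R(1)[OF that] by simp
  have small: "S y \<le> \<epsilon> y / 3" if "y \<in> Y" for y
    unfolding S_def using le that by (intro cSUP_least) auto
  have lip: "S y \<le> S z + dist y z" if "y \<in> Y" "z \<in> Y" for y z
    unfolding S_def[of y]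
  proof (rule cSUP_least)
    show "R p - dist p y \<le> S z + dist y z" if "p \<in> Y" for p
      using upper[OF that \<open>z \<in> Y\<close>] dist_triangle[of p z y] by linarith
  qed (use that in auto)
  have "Lipschitz_contracts_in Y (ball y (S y / 2)) (ball y (\<epsilon> y))" if y: "y \<in> Y" for y
  proof -
    have "S y / 2 < (SUP p\<in>Y. R p - dist p y)" using pos[OF y] by (simp add: S_def)
    then obtain p where p: "p \<in> Y" "S y / 2 < R p - dist p y"
      using less_cSUP_iff[OF _ bdd[OF y]] y by blast
    have "ball y (S y / 2) \<subseteq> ball p (R p)"
    proof
      fix x assume "x \<in> ball y (S y / 2)"
      then show "x \<in> ball p (R p)" using p(2) dist_triangle[of p x y] by simp
    qed
    moreover have "ball p (\<epsilon> p / 3) \<subseteq> ball y (\<epsilon> y)"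
    proof
      fix x assume "x \<in> ball p (\<epsilon> p / 3)"
      moreover have "dist p y < \<epsilon> p / 3" using p(2) pos[OF y] R(2)[OF p(1)] by linarith
      ultimately show "x \<in> ball y (\<epsilon> y)"
        using \<epsilon>(2)[OF p(1) y] dist_triangle[of y x p] by (simp add: dist_commute)
    qed
    ultimately show ?thesis using Lipschitz_contracts_in_mono R(3)[OF p(1)] by blast
  qed
  moreover have "0 < S y / 2 \<and> S y / 2 \<le> \<epsilon> y" if "y \<in> Y" for y
    using pos[OF that] small[OF that] \<epsilon>(1)[OF that] by simp
  moreover have "S y / 2 \<le> S z / 2 + dist y z" if "y \<in> Y" "z \<in> Y" for y z
    using lip[OF that] zero_le_dist[of y z] by linarith
  ultimately show ?thesis by (intro exI[of _ "\<lambda>y. S y / 2"]) blast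
qed

text \<open>
  The halved radius of the larger ball leaves room for replacing its centre by a nearby one.
\<close>

definition contraction_ladder :: "'b::metric_space set \<Rightarrow> (nat \<Rightarrow> 'b \<Rightarrow> real) \<Rightarrow> bool" where
  "contraction_ladder Y \<rho> \<longleftrightarrow> (\<forall>k. \<forall>y\<in>Y. 0 < \<rho> k y \<and> \<rho> (Suc k) y \<le> \<rho> k y \<and>
     Lipschitz_contracts_in Y (ball y (\<rho> (Suc k) y)) (ball y (\<rho> k y / 2)) \<and>
     (\<forall>z\<in>Y. \<rho> k y \<le> \<rho> k z + dist y z))"

lemma ex_contraction_ladder:
  fixes Y :: "'b::metric_space set"
  assumes Y: "locally_Lipschitz_contractible Y"
  shows "\<exists>\<rho>. contraction_ladder Y \<rho>"
proof -
  let ?P = "\<lambda>\<rho>. (\<forall>y\<in>Y. 0 < \<rho> y) \<and> (\<forall>y\<in>Y. \<forall>z\<in>Y. \<rho> y \<le> \<rho> z + dist y z)"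
  let ?Q = "\<lambda>\<rho> \<rho>'. \<forall>y\<in>Y. \<rho>' y \<le> \<rho> y \<and> Lipschitz_contracts_in Y (ball y (\<rho>' y)) (ball y (\<rho> y / 2))"
  have "\<exists>f. \<forall>n. ?P (f n) \<and> ?Q (f n) (f (Suc n))"
  proof (rule dependent_nat_choice)
    show "\<exists>\<rho>. ?P \<rho>" by (intro exI[of _ "\<lambda>_. 1"]) auto
    fix \<rho> :: "'b \<Rightarrow> real" assume \<rho>: "?P \<rho>"
    have "\<exists>\<rho>'. (\<forall>y\<in>Y. 0 < \<rho>' y \<and> \<rho>' y \<le> \<rho> y / 2) \<and> (\<forall>y\<in>Y. \<forall>z\<in>Y. \<rho>' y \<le> \<rho>' z + dist y z) \<and>
      (\<forall>y\<in>Y. Lipschitz_contracts_in Y (ball y (\<rho>' y)) (ball y (\<rho> y / 2)))"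
    proof (rule contraction_radius[OF Y])
      show "\<rho> y / 2 \<le> \<rho> z / 2 + dist y z" if "y \<in> Y" "z \<in> Y" for y z
      proof -
        have "\<rho> y \<le> \<rho> z + dist y z" using \<rho> that by blast
        then show ?thesis using zero_le_dist[of y z] by linarith
      qed
    qed (use \<rho> in auto)
    then obtain \<rho>' where \<rho>': "\<forall>y\<in>Y. 0 < \<rho>' y \<and> \<rho>' y \<le> \<rho> y / 2"
        "\<forall>y\<in>Y. \<forall>z\<in>Y. \<rho>' y \<le> \<rho>' z + dist y z"
        "\<forall>y\<in>Y. Lipschitz_contracts_in Y (ball y (\<rho>' y)) (ball y (\<rho> y / 2))" by blast
    have "\<rho>' y \<le> \<rho> y" if "y \<in> Y" for y
    proof -
      have "\<rho>' y \<le> \<rho> y / 2" "0 < \<rho> y" using \<rho>'(1) \<rho> that by auto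
      then show ?thesis by linarith
    qed
    then show "\<exists>\<rho>'. ?P \<rho>' \<and> ?Q \<rho> \<rho>'" using \<rho>' by (intro exI[of _ \<rho>']) blast
  qed
  then show ?thesis unfolding contraction_ladder_def by blast
qed

lemma contraction_ladderD:
  assumes "contraction_ladder Y \<rho>" "y \<in> Y"
  shows "0 < \<rho> k y" "\<rho> (Suc k) y \<le> \<rho> k y"
    "Lipschitz_contracts_in Y (ball y (\<rho> (Suc k) y)) (ball y (\<rho> k y / 2))"
    "z \<in> Y \<Longrightarrow> \<rho> k y \<le> \<rho> k z + dist y z"
proof -
  note * = bspec[OF spec[OF assms(1)[unfolded contraction_ladder_def], of k] assms(2)]
  show "0 < \<rho> k y" "\<rho> (Suc k) y \<le> \<rho> k y"
    "Lipschitz_contracts_in Y (ball y (\<rho> (Suc k) y)) (ball y (\<rho> k y / 2))"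
    using * by auto
  show "z \<in> Y \<Longrightarrow> \<rho> k y \<le> \<rho> k z + dist y z" using * by auto
qed

lemma contraction_ladder_antimono:
  assumes "contraction_ladder Y \<rho>" "y \<in> Y" "k \<le> n"
  shows "\<rho> n y \<le> \<rho> k y"
proof (rule lift_Suc_antimono_le[OF _ assms(3)])
  show "\<rho> (Suc n) y \<le> \<rho> n y" for n by (rule contraction_ladderD(2)[OF assms(1,2)])
qed

section \<open>Approximation over a fine cover\<close>

definition Lipschitz_approximation ::
    "'p::metric_space set \<Rightarrow> 'b::metric_space set \<Rightarrow> ('p \<Rightarrow> 'b) \<Rightarrow> ('p \<times> real \<Rightarrow> 'b) \<Rightarrow> bool" where
  "Lipschitz_approximation P Y h H \<longleftrightarrow>
     continuous_on (P \<times> {0..1}) H \<and> H \<in> P \<times> {0..1} \<rightarrow> Y \<and> (\<forall>x\<in>P. H (x, 0) = h x) \<and>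
     locally_Lipschitz_map P Y (\<lambda>x. H (x, 1)) \<and>
     (\<forall>S\<subseteq>P. locally_Lipschitz_map S Y h \<longrightarrow> locally_Lipschitz_map (S \<times> {0..1}) Y H)"

text \<open>
  Here \<open>D \<sigma>\<close> is the ball of radius \<open>\<rho> (card \<sigma>)\<close> about the image of some point at which
  all weights on \<open>\<sigma>\<close> are positive. Its contraction stays in the ball of half the radius
  \<open>\<rho> (card \<sigma> - 1)\<close>, and the balls of smaller sets have at least twice that radius, up to the change of centres. The
  change of centres is small by \<open>fine\<close>, and the remaining half of the radius absorbs it. The hypothesis \<open>order\<close> ensures that
  no radius smaller than \<open>\<rho> (N i)\<close> occurs for a set containing \<open>i\<close>, so that \<open>fine\<close> controls
  the distances in comparison with all of them.
\<close>

lemma Lipschitz_approximation_of_fine_nerve: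
  fixes P :: "'p::metric_space set" and Y :: "'b::metric_space set"
  assumes t: "weighted_nerve P t" and ladder: "contraction_ladder Y \<rho>"
    and h: "h \<in> P \<rightarrow> Y" "continuous_on P h"
    and order: "\<And>x i. x \<in> P \<Longrightarrow> i \<in> supp (t x) \<Longrightarrow> card (supp (t x)) \<le> N i"
    and fine: "\<And>x z i. x \<in> P \<Longrightarrow> z \<in> P \<Longrightarrow> i \<in> supp (t x) \<Longrightarrow> i \<in> supp (t z) \<Longrightarrow>
      dist (h x) (h z) < \<rho> (N i) (h z) / 4"
  shows "\<exists>H. Lipschitz_approximation P Y h H"
proof -
  interpret weighted_nerve P t by (rule t(1))
  have "\<exists>x. x \<in> P \<and> \<sigma> \<subseteq> supp (t x)" if "\<sigma> \<in> nerve P t" for \<sigma>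
    using that by (auto simp: nerve_def)
  then obtain c where c: "\<And>\<sigma>. \<sigma> \<in> nerve P t \<Longrightarrow> c \<sigma> \<in> P \<and> \<sigma> \<subseteq> supp (t (c \<sigma>))"
    by metis
  have ne: "\<sigma> \<noteq> {}" if "\<sigma> \<in> nerve P t" for \<sigma> using that by (simp add: nerve_def)
  have fin: "finite \<sigma>" if "\<sigma> \<in> nerve P t" for \<sigma>
    by (rule finite_subset[OF conjunct2[OF c[OF that]] finite_supp[OF conjunct1[OF c[OF that]]]])
  define q where "q \<sigma> = h (c \<sigma>)" for \<sigma>
  have qY: "q \<sigma> \<in> Y" if "\<sigma> \<in> nerve P t" for \<sigma> using c[OF that] h(1) by (auto simp: q_def)
  define D where "D \<sigma> = Y \<inter> ball (q \<sigma>) (\<rho> (card \<sigma>) (q \<sigma>))" for \<sigma>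
  have near: "dist (h x) (q \<sigma>) < \<rho> (card \<sigma>) (q \<sigma>) / 4"
    if \<sigma>: "\<sigma> \<in> nerve P t" and x: "x \<in> P" "\<sigma> \<subseteq> supp (t x)" for x \<sigma>
  proof -
    obtain i where i: "i \<in> \<sigma>" using ne[OF \<sigma>] by blast
    have "card \<sigma> \<le> card (supp (t x))" using x finite_supp by (intro card_mono) auto
    also have "\<dots> \<le> N i" using order x i by blast
    finally have "\<rho> (N i) (q \<sigma>) \<le> \<rho> (card \<sigma>) (q \<sigma>)"
      by (rule contraction_ladder_antimono[OF ladder qY[OF \<sigma>]])
    moreover have "dist (h x) (q \<sigma>) < \<rho> (N i) (q \<sigma>) / 4"
      unfolding q_def using x i c[OF \<sigma>] by (intro fine) auto
    ultimately show ?thesis by simp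
  qed
  have contracts: "Lipschitz_contracts_in Y (ball (q \<sigma>) (\<rho> (card \<sigma>) (q \<sigma>))) (ball (q \<sigma>) (\<rho> (card \<sigma> - 1) (q \<sigma>) / 2))"
    if \<sigma>: "\<sigma> \<in> nerve P t" for \<sigma>
  proof -
    have "card \<sigma> > 0" using fin[OF \<sigma>] ne[OF \<sigma>] by (simp add: card_gt_0_iff)
    then show ?thesis using contraction_ladderD(3)[OF ladder qY[OF \<sigma>], of "card \<sigma> - 1"] by simp
  qed
  define R where "R \<sigma> \<phi> \<longleftrightarrow> (\<exists>L. L-lipschitz_on (D \<sigma> \<times> {0..1::real}) \<phi>) \<and>
     \<phi> \<in> D \<sigma> \<times> {0..1} \<rightarrow> Y \<inter> ball (q \<sigma>) (\<rho> (card \<sigma> - 1) (q \<sigma>) / 2) \<and>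
     (\<forall>x\<in>D \<sigma>. \<phi> (x, 0) = x) \<and> (\<forall>x\<in>D \<sigma>. \<forall>z\<in>D \<sigma>. \<phi> (x, 1) = \<phi> (z, 1))" for \<sigma> \<phi>
  have "\<exists>\<phi>. R \<sigma> \<phi>" if "\<sigma> \<in> nerve P t" for \<sigma>
    unfolding R_def D_def using contracts[OF that] unfolding Lipschitz_contracts_in_def .
  then obtain F where "\<And>\<sigma>. \<sigma> \<in> nerve P t \<Longrightarrow> R \<sigma> (F \<sigma>)" by metis
  note R = this[unfolded R_def]
  have F: "\<exists>L. L-lipschitz_on (D \<sigma> \<times> {0..1::real}) (F \<sigma>)"
    "F \<sigma> \<in> D \<sigma> \<times> {0..1} \<rightarrow> Y \<inter> ball (q \<sigma>) (\<rho> (card \<sigma> - 1) (q \<sigma>) / 2)"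
    "\<And>x. x \<in> D \<sigma> \<Longrightarrow> F \<sigma> (x, 0) = x"
    "\<And>x z. x \<in> D \<sigma> \<Longrightarrow> z \<in> D \<sigma> \<Longrightarrow> F \<sigma> (x, 1) = F \<sigma> (z, 1)"
    if "\<sigma> \<in> nerve P t" for \<sigma>
    using R[OF that] by blast+
  interpret nerve_homotopy P t D F h
  proof
    fix \<sigma> \<tau> y and s :: real
    assume \<sigma>: "\<sigma> \<in> nerve P t" and \<tau>: "\<tau> \<in> nerve P t" "\<tau> \<subset> \<sigma>" and y: "y \<in> D \<sigma>" "s \<in> {0..1}"
    have F': "F \<sigma> (y, s) \<in> Y" "dist (q \<sigma>) (F \<sigma> (y, s)) < \<rho> (card \<sigma> - 1) (q \<sigma>) / 2"
      using F(2)[OF \<sigma>] y by auto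
    have "card \<tau> < card \<sigma>" using \<tau> fin[OF \<sigma>] psubset_card_mono by blast
    then have "\<rho> (card \<sigma> - 1) (q \<sigma>) \<le> \<rho> (card \<tau>) (q \<sigma>)"
      by (intro contraction_ladder_antimono[OF ladder qY[OF \<sigma>]]) auto
    also have "\<dots> \<le> \<rho> (card \<tau>) (q \<tau>) + dist (q \<sigma>) (q \<tau>)"
      by (rule contraction_ladderD(4)[OF ladder qY[OF \<sigma>] qY[OF \<tau>(1)]])
    finally have 1: "\<rho> (card \<sigma> - 1) (q \<sigma>) \<le> \<rho> (card \<tau>) (q \<tau>) + dist (q \<sigma>) (q \<tau>)" .
    have 2: "dist (q \<sigma>) (q \<tau>) < \<rho> (card \<tau>) (q \<tau>) / 4"
      unfolding q_def[of \<sigma>] using c[OF \<sigma>] \<tau> by (intro near) auto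
    have "dist (q \<tau>) (F \<sigma> (y, s)) < \<rho> (card \<tau>) (q \<tau>)"
      using 1 2 F'(2) dist_triangle[of "q \<tau>" "F \<sigma> (y, s)" "q \<sigma>"] dist_commute[of "q \<tau>" "q \<sigma>"]
        contraction_ladderD(1)[OF ladder qY[OF \<tau>(1)], of "card \<tau>"] by linarith
    then show "F \<sigma> (y, s) \<in> D \<tau>" using F'(1) by (simp add: D_def)
  next
    fix x \<sigma> assume x: "x \<in> P" "\<sigma> \<noteq> {}" "\<sigma> \<subseteq> supp (t x)"
    then have \<sigma>: "\<sigma> \<in> nerve P t" by (auto simp: nerve_def)
    have "dist (q \<sigma>) (h x) < \<rho> (card \<sigma>) (q \<sigma>)"
      using near[OF \<sigma> x(1,3)] contraction_ladderD(1)[OF ladder qY[OF \<sigma>], of "card \<sigma>"]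
        dist_commute[of "h x" "q \<sigma>"] by linarith
    then show "h x \<in> D \<sigma>" using h(1) x(1) by (auto simp: D_def)
  qed (rule fin ne F, assumption+)+
  have Y: "homotopy (x, s) \<in> Y" if "x \<in> P" "s \<in> {0..1}" for x s
  proof (rule homotopy_mem[OF that])
    show "h x \<in> Y" using h(1) that(1) by blast
    show "F \<sigma> (y, r) \<in> Y" if "\<sigma> \<in> nerve P t" "y \<in> D \<sigma>" "r \<in> {0..1}" for \<sigma> y r
      using F(2)[OF that(1)] that(2,3) by blast
  qed
  have "homotopy \<in> P \<times> {0..1} \<rightarrow> Y" using Y by auto
  moreover have "locally_Lipschitz_map P Y (\<lambda>x. homotopy (x, 1))"
    by (rule homotopy_end_locally_Lipschitz_map) (use Y in auto)
  moreover have "locally_Lipschitz_map (S \<times> {0..1}) Y homotopy"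
    if "S \<subseteq> P" "locally_Lipschitz_map S Y h" for S
    by (rule homotopy_locally_Lipschitz_map[OF that]) (use Y that in auto)
  ultimately show ?thesis
    using homotopy_continuous_on[OF h(2)] homotopy_at_0 unfolding Lipschitz_approximation_def
    by (intro exI[of _ homotopy]) blast
qed

section \<open>Fine covers of bounded order\<close>

lemma near_integer_cases:
  fixes x :: real and a :: nat
  assumes "0 \<le> x" "\<bar>x - a\<bar> < 1"
  shows "a \<in> {nat \<lfloor>x\<rfloor>, Suc (nat \<lfloor>x\<rfloor>)}"
proof -
  have "int a = \<lfloor>x\<rfloor> \<or> int a = \<lfloor>x\<rfloor> + 1" using assms by linarith
  then show ?thesis using assms(1) by auto
qed

text \<open>
  Inside \<open>U\<close> only the weights of the neighbours of \<open>U\<close> are nonzero. The open cubes of side \<open>2 / m\<close>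
  centred at the points of a grid of mesh \<open>1 / m\<close> in these coordinates and in the interval
  cover \<open>U \<times> [0,1]\<close>, and each coordinate meets at most two grid positions, whatever \<open>m\<close> is. So the bound
  \<open>M\<close> is fixed before \<open>\<eta>\<close>, as the order of quantifiers requires.
\<close>

lemma fine_product_cover:
  fixes X :: "'a::metric_space set"
  assumes cov: "relatively_compact_cover X \<U>"
    and t: "weighted_nerve X t" "\<forall>x\<in>X. supp (t x) = {U\<in>\<U>. x \<in> U}"
  shows "\<exists>M. \<forall>\<eta>. (\<forall>U\<in>\<U>. 0 < \<eta> U) \<longrightarrow> (\<exists>\<W>. relatively_compact_cover (X \<times> {0..1::real}) \<W> \<and>
    (\<forall>W\<in>\<W>. \<exists>U\<in>\<U>. W \<subseteq> U \<times> {0..1} \<and> (\<forall>p\<in>W. card {V\<in>\<W>. p \<in> V} \<le> M U) \<and>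
      (\<forall>p\<in>W. \<forall>q\<in>W. \<bar>snd p - snd q\<bar> \<le> \<eta> U \<and> (\<forall>V. \<bar>t (fst p) V - t (fst q) V\<bar> \<le> \<eta> U))))"
proof -
  interpret weighted_nerve X t by (rule t(1))
  note supp_t = t(2)[rule_format]
  let ?nb = "\<lambda>U. {V\<in>\<U>. V \<inter> U \<noteq> {}}"
  have UX: "\<Union>\<U> = X" and lf: "locally_finite_in (top_of_set X) \<U>"
    using cov by (auto simp: relatively_compact_cover_def)
  have UX': "U \<subseteq> X" if "U \<in> \<U>" for U using UX that by blast
  have fin: "finite (?nb U)" if "U \<in> \<U>" for U by (rule finite_neighbours[OF cov that])
  have cont: "continuous_on X (\<lambda>x. t x V)" for V
    using weights_Lipschitz[of V] lipschitz_on_continuous_on by blast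
  have off: "t x V = 0" if "x \<in> U" "U \<in> \<U>" "V \<notin> ?nb U" for x U V
  proof -
    have "x \<in> X" using that UX by blast
    then have "V \<notin> supp (t x)" using that supp_t by blast
    then show ?thesis by (simp add: supp_def)
  qed
  have bounded: "\<exists>b. \<forall>x\<in>U. \<forall>V\<in>?nb U. t x V \<le> b" if U: "U \<in> \<U>" for U
  proof -
    obtain C where C: "compact C" "U \<subseteq> C" "C \<subseteq> X"
      using cov U unfolding relatively_compact_cover_def by blast
    have "\<exists>b. \<forall>x\<in>C. t x V \<le> b" for V
    proof -
      have "compact ((\<lambda>x. t x V) ` C)"
        using C cont by (meson compact_continuous_image continuous_on_subset)
      then have "bdd_above ((\<lambda>x. t x V) ` C)" by (intro bounded_imp_bdd_above compact_imp_bounded)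
      then show ?thesis by (auto simp: bdd_above_def)
    qed
    then obtain b where b: "\<And>V x. x \<in> C \<Longrightarrow> t x V \<le> b V" by metis
    have "t x V \<le> (\<Sum>V\<in>?nb U. \<bar>b V\<bar>)" if "x \<in> U" "V \<in> ?nb U" for x V
    proof -
      have "t x V \<le> \<bar>b V\<bar>" using b[of x V] that C by fastforce
      also have "\<dots> \<le> (\<Sum>V\<in>?nb U. \<bar>b V\<bar>)"
        by (rule member_le_sum) (use that fin[OF U] in auto)
      finally show ?thesis .
    qed
    then show ?thesis by blast
  qed
  define M :: "'a set \<Rightarrow> nat" where "M U = (\<Sum>V\<in>?nb U. 2 ^ card (?nb V) * 2)" for U
  have main: "\<exists>\<W>. relatively_compact_cover (X \<times> {0..1::real}) \<W> \<and>
    (\<forall>W\<in>\<W>. \<exists>U\<in>\<U>. W \<subseteq> U \<times> {0..1} \<and> (\<forall>p\<in>W. card {V\<in>\<W>. p \<in> V} \<le> M U) \<and>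
      (\<forall>p\<in>W. \<forall>q\<in>W. \<bar>snd p - snd q\<bar> \<le> \<eta> U \<and> (\<forall>V. \<bar>t (fst p) V - t (fst q) V\<bar> \<le> \<eta> U)))"
    if \<eta>: "\<And>U. U \<in> \<U> \<Longrightarrow> 0 < \<eta> U" for \<eta> :: "'a set \<Rightarrow> real"
  proof -
    have "\<exists>m::nat. 0 < m \<and> 2 / real m \<le> \<eta> U" if U: "U \<in> \<U>" for U
    proof -
      obtain m :: nat where m: "2 / \<eta> U < real m" using reals_Archimedean2 by blast
      have "0 < 2 / \<eta> U" using \<eta>[OF U] by simp
      then have "0 < real m" using m by linarith
      then have "0 < m" by simp
      moreover from this have "2 / real m \<le> \<eta> U" using m \<eta>[OF U] by (simp add: field_simps)
      ultimately show ?thesis by blast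
    qed
    then obtain m :: "'a set \<Rightarrow> nat" where m: "\<And>U. U \<in> \<U> \<Longrightarrow> 0 < m U" "\<And>U. U \<in> \<U> \<Longrightarrow> 2 / real (m U) \<le> \<eta> U"
      by metis
    have "\<exists>b::nat. \<forall>x\<in>U. \<forall>V\<in>?nb U. m U * t x V \<le> b" if U: "U \<in> \<U>" for U
    proof -
      obtain b where b: "\<And>x V. x \<in> U \<Longrightarrow> V \<in> ?nb U \<Longrightarrow> t x V \<le> b" using bounded[OF U] by blast
      obtain B :: nat where B: "m U * b \<le> B" using real_arch_simple by blast
      have "m U * t x V \<le> B" if "x \<in> U" "V \<in> ?nb U" for x V
        using b[OF that] B by (meson mult_left_mono of_nat_0_le_iff order_trans)
      then show ?thesis by blast
    qed
    then have "\<forall>U\<in>\<U>. \<exists>b::nat. \<forall>x\<in>U. \<forall>V\<in>?nb U. m U * t x V \<le> b" by (rule ballI)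
    from bchoice[OF this] obtain B :: "'a set \<Rightarrow> nat"
      where B: "\<forall>U\<in>\<U>. \<forall>x\<in>U. \<forall>V\<in>?nb U. m U * t x V \<le> B U"
      by (elim exE) (rule that)
    \<comment> \<open>\<open>c\<close> consists of the grid position in the weight coordinates and that in the interval\<close>
    define cell where "cell U c = {p :: 'a \<times> real. fst p \<in> U \<and> snd p \<in> {0..1::real} \<and>
      (\<forall>V\<in>?nb U. \<bar>m U * t (fst p) V - real (fst c V)\<bar> < 1) \<and> \<bar>m U * snd p - real (snd c)\<bar> < 1}"
      for U and c :: "('a set \<Rightarrow> nat) \<times> nat"
    define Ix where "Ix U = (PiE (?nb U) (\<lambda>_. {..B U})) \<times> {..m U}" for U
    define \<W> where "\<W> = (\<Union>U\<in>\<U>. cell U ` Ix U)"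
    have finIx: "finite (Ix U)" if "U \<in> \<U>" for U
      unfolding Ix_def using fin[OF that] by (intro finite_cartesian_product finite_PiE) auto
    have cellU: "cell U c \<subseteq> U \<times> {0..1::real}" for U c by (auto simp: cell_def)
    have covers: "\<exists>c\<in>Ix U. p \<in> cell U c" if U: "U \<in> \<U>" and p: "p \<in> U \<times> {0..1::real}" for U p
    proof -
      let ?a = "restrict (\<lambda>V. nat \<lfloor>m U * t (fst p) V\<rfloor>) (?nb U)" and ?b = "nat \<lfloor>m U * snd p\<rfloor>"
      have fp: "fst p \<in> U" "fst p \<in> X" "snd p \<in> {0..1}" using p U UX by auto
      have "nat \<lfloor>m U * t (fst p) V\<rfloor> \<le> B U" if "V \<in> ?nb U" for V
        using bspec[OF bspec[OF bspec[OF B U] fp(1)] that] by linarith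
      moreover have "real (m U) * snd p \<le> real (m U) * 1" using fp by (intro mult_left_mono) auto
      then have "?b \<le> m U" by linarith
      ultimately have "(?a, ?b) \<in> Ix U" by (auto simp: Ix_def)
      moreover have near: "\<bar>z - real (nat \<lfloor>z\<rfloor>)\<bar> < 1" if "0 \<le> z" for z :: real
        using that by linarith
      have "\<bar>m U * t (fst p) V - real (?a V)\<bar> < 1" if "V \<in> ?nb U" for V
        using near[of "m U * t (fst p) V"] weights_nonneg[OF fp(2)] that by simp
      moreover have "\<bar>m U * snd p - real ?b\<bar> < 1" using near fp by simp
      ultimately show ?thesis using fp by (intro bexI[of _ "(?a, ?b)"]) (auto simp: cell_def)
    qed
    have opn: "openin (top_of_set (X \<times> {0..1::real})) (cell U c)" if U: "U \<in> \<U>" for U c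
    proof -
      let ?T = "top_of_set (X \<times> {0..1::real})"
      have "openin (top_of_set X) U" using cov U by (simp add: relatively_compact_cover_def)
      then obtain G where G: "open G" "U = X \<inter> G" by (auto simp: openin_open)
      let ?f = "\<lambda>V (p :: 'a \<times> real). \<bar>m U * t (fst p) V - real (fst c V)\<bar>"
      let ?A = "X \<times> {0..1::real} \<inter> fst -` G"
      let ?B = "X \<times> {0..1::real} \<inter> (\<lambda>p :: 'a \<times> real. \<bar>m U * snd p - real (snd c)\<bar>) -` {..<1}"
      let ?C = "\<lambda>V. X \<times> {0..1} \<inter> ?f V -` {..<1}"
      have "continuous_on (X \<times> {0..1::real}) (\<lambda>p. t (fst p) V)" for V
        by (rule continuous_on_compose2[OF cont[of V]]) (auto intro: continuous_intros)
      then have "openin ?T (?C V)" for V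
        by (intro continuous_openin_preimage_gen continuous_intros) auto
      moreover have "openin ?T ?A" "openin ?T ?B"
        by (intro continuous_openin_preimage_gen continuous_intros G(1); simp)+
      then have "openin ?T (?A \<inter> ?B)" by (rule openin_Int)
      ultimately have "openin ?T (?A \<inter> ?B \<inter> \<Inter>(?C ` ?nb U))"
        using fin[OF U] by (intro openin_Int_Inter) auto
      moreover have "cell U c = ?A \<inter> ?B \<inter> \<Inter>(?C ` ?nb U)"
        using G(2) by (auto simp: cell_def)
      ultimately show ?thesis by simp
    qed
    have "relatively_compact_cover (X \<times> {0..1::real}) \<W>"
      unfolding relatively_compact_cover_def
    proof (intro conjI ballI)
      fix W assume "W \<in> \<W>"
      then obtain U c where U: "U \<in> \<U>" "W = cell U c" by (auto simp: \<W>_def)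
      show "openin (top_of_set (X \<times> {0..1})) W" using opn[OF U(1)] U(2) by simp
      obtain C where C: "compact C" "U \<subseteq> C" "C \<subseteq> X"
        using cov U(1) unfolding relatively_compact_cover_def by blast
      show "\<exists>C. compact C \<and> W \<subseteq> C \<and> C \<subseteq> X \<times> {0..1}"
        using C U(2) cellU[of U c] by (intro exI[of _ "C \<times> {0..1}"]) (auto intro: compact_Times)
    next
      show *: "\<Union>\<W> = X \<times> {0..1}"
      proof
        show "\<Union>\<W> \<subseteq> X \<times> {0..1}" using cellU UX by (fastforce simp: \<W>_def)
        show "X \<times> {0..1} \<subseteq> \<Union>\<W>"
        proof
          fix p assume p: "p \<in> X \<times> {0..1::real}"
          then obtain U where "U \<in> \<U>" "fst p \<in> U" using UX by auto
          then show "p \<in> \<Union>\<W>" using covers[of U p] p by (fastforce simp: \<W>_def)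
        qed
      qed
      show "locally_finite_in (top_of_set (X \<times> {0..1})) \<W>"
        unfolding locally_finite_in_def
      proof (intro conjI ballI)
        show "\<Union>\<W> \<subseteq> topspace (top_of_set (X \<times> {0..1}))" using * by simp
        fix p assume "p \<in> topspace (top_of_set (X \<times> {0..1::real}))"
        then have p: "p \<in> X \<times> {0..1}" by simp
        then have "fst p \<in> X" by auto
        then obtain r where r: "r > 0" "finite {U\<in>\<U>. U \<inter> ball (fst p) r \<noteq> {}}"
          using locally_finite_in_ball[OF lf] by blast
        let ?V = "X \<times> {0..1} \<inter> ball p r"
        have "{W\<in>\<W>. W \<inter> ?V \<noteq> {}} \<subseteq> (\<Union>U\<in>{U\<in>\<U>. U \<inter> ball (fst p) r \<noteq> {}}. cell U ` Ix U)"
        proof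
          fix W assume W: "W \<in> {W\<in>\<W>. W \<inter> ?V \<noteq> {}}"
          then have "W \<in> (\<Union>U\<in>\<U>. cell U ` Ix U)" by (simp add: \<W>_def)
          then obtain U c where U: "U \<in> \<U>" "c \<in> Ix U" "W = cell U c" by blast
          from W obtain q where q: "q \<in> W" "q \<in> ball p r" by blast
          have "fst q \<in> U" using q(1) U(3) cellU[of U c] by auto
          moreover have "fst q \<in> ball (fst p) r" using q(2) dist_fst_le[of p q] by simp
          ultimately show "W \<in> (\<Union>U\<in>{U\<in>\<U>. U \<inter> ball (fst p) r \<noteq> {}}. cell U ` Ix U)"
            using U by blast
        qed
        moreover have "finite (\<Union>U\<in>{U\<in>\<U>. U \<inter> ball (fst p) r \<noteq> {}}. cell U ` Ix U)"
          using r(2) finIx by auto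
        ultimately have "finite {W\<in>\<W>. W \<inter> ?V \<noteq> {}}" using finite_subset by blast
        moreover have "openin (top_of_set (X \<times> {0..1})) ?V" by (simp add: openin_open_Int)
        ultimately show "\<exists>V. openin (top_of_set (X \<times> {0..1})) V \<and> p \<in> V \<and> finite {W\<in>\<W>. W \<inter> V \<noteq> {}}"
          using p r(1) by (intro exI[of _ ?V]) auto
      qed
    qed
    moreover have "\<exists>U\<in>\<U>. W \<subseteq> U \<times> {0..1} \<and> (\<forall>p\<in>W. card {V\<in>\<W>. p \<in> V} \<le> M U) \<and>
      (\<forall>p\<in>W. \<forall>q\<in>W. \<bar>snd p - snd q\<bar> \<le> \<eta> U \<and> (\<forall>V. \<bar>t (fst p) V - t (fst q) V\<bar> \<le> \<eta> U))"
      if W: "W \<in> \<W>" for W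
    proof -
      have "W \<in> (\<Union>U\<in>\<U>. cell U ` Ix U)" using W by (simp add: \<W>_def)
      then obtain U c where U: "U \<in> \<U>" "c \<in> Ix U" "W = cell U c" by blast
      have WU: "W \<subseteq> U \<times> {0..1}" using U(3) cellU by simp
      have "card {V\<in>\<W>. p \<in> V} \<le> M U" if p: "p \<in> W" for p
      proof -
        let ?two = "\<lambda>z::real. {nat \<lfloor>z\<rfloor>, Suc (nat \<lfloor>z\<rfloor>)}"
        define J where "J V = PiE (?nb V) (\<lambda>Z. ?two (m V * t (fst p) Z)) \<times> ?two (m V * snd p)" for V
        have "p \<in> U \<times> {0..1}" using p WU by blast
        then have px: "fst p \<in> U" "fst p \<in> X" "snd p \<in> {0..1}" using UX'[OF U(1)] by auto
        have finJ: "finite (J V)" if "V \<in> \<U>" for V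
          unfolding J_def using fin[OF that] by (intro finite_cartesian_product finite_PiE) auto
        have cardJ: "card (J V) \<le> 2 ^ card (?nb V) * 2" if V: "V \<in> \<U>" for V
        proof -
          have "card (PiE (?nb V) (\<lambda>Z. ?two (m V * t (fst p) Z))) = (\<Prod>Z\<in>?nb V. 2)"
            by (subst card_PiE[OF fin[OF V]]) (simp add: numeral_2_eq_2)
          then show ?thesis by (simp add: J_def card_cartesian_product numeral_2_eq_2)
        qed
        have "{V\<in>\<W>. p \<in> V} \<subseteq> (\<Union>V\<in>?nb U. cell V ` J V)"
        proof
          fix W' assume W': "W' \<in> {V\<in>\<W>. p \<in> V}"
          then have "W' \<in> (\<Union>U\<in>\<U>. cell U ` Ix U)" by (simp add: \<W>_def)
          then obtain V e where V: "V \<in> \<U>" "e \<in> Ix V" "W' = cell V e" by blast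
          from this W' have p: "p \<in> cell V e" by blast
          have pe: "fst p \<in> V" "\<And>Z. Z \<in> ?nb V \<Longrightarrow> \<bar>m V * t (fst p) Z - real (fst e Z)\<bar> < 1"
            "\<bar>m V * snd p - real (snd e)\<bar> < 1" using p by (auto simp: cell_def)
          have "fst e \<in> PiE (?nb V) (\<lambda>Z. ?two (m V * t (fst p) Z))"
          proof (rule PiE_I)
            show "fst e Z \<in> ?two (m V * t (fst p) Z)" if "Z \<in> ?nb V" for Z
              using near_integer_cases pe(2)[OF that] weights_nonneg[OF px(2)] by simp
            show "fst e Z = undefined" if "Z \<notin> ?nb V" for Z
              using V(2) that by (auto simp: Ix_def PiE_def extensional_def)
          qed
          moreover have "snd e \<in> ?two (m V * snd p)"
            using pe(3) px(3) by (intro near_integer_cases) auto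
          ultimately have "e \<in> J V" unfolding J_def by (cases e) auto
          moreover have "V \<in> ?nb U" using V(1) pe(1) px(1) by blast
          ultimately show "W' \<in> (\<Union>V\<in>?nb U. cell V ` J V)" using V(3) by blast
        qed
        moreover have "finite (\<Union>V\<in>?nb U. cell V ` J V)" using fin[OF U(1)] finJ by auto
        ultimately have "card {V\<in>\<W>. p \<in> V} \<le> card (\<Union>V\<in>?nb U. cell V ` J V)" by (rule card_mono[rotated])
        also have "\<dots> \<le> (\<Sum>V\<in>?nb U. card (cell V ` J V))" by (rule card_UN_le[OF fin[OF U(1)]])
        also have "\<dots> \<le> M U" unfolding M_def
        proof (rule sum_mono)
          fix V assume "V \<in> ?nb U"
          then have "V \<in> \<U>" by simp
          then show "card (cell V ` J V) \<le> 2 ^ card (?nb V) * 2"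
            using card_image_le[OF finJ] cardJ order_trans by blast
        qed
        finally show ?thesis .
      qed
      moreover have "\<bar>snd p - snd q\<bar> \<le> \<eta> U \<and> (\<forall>V. \<bar>t (fst p) V - t (fst q) V\<bar> \<le> \<eta> U)"
        if pq: "p \<in> W" "q \<in> W" for p q
      proof -
        have close: "\<bar>u - v\<bar> \<le> \<eta> U" if "\<bar>m U * u - k\<bar> < 1" "\<bar>m U * v - k\<bar> < 1" for u v k :: real
        proof -
          have "m U * \<bar>u - v\<bar> = \<bar>m U * u - m U * v\<bar>" by (simp add: right_diff_distrib[symmetric] abs_mult)
          also have "\<dots> < 2" using that by linarith
          finally have "\<bar>u - v\<bar> < 2 / m U" using m(1)[OF U(1)] by (simp add: field_simps)
          then show ?thesis using m(2)[OF U(1)] by linarith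
        qed
        have "\<bar>t (fst p) V - t (fst q) V\<bar> \<le> \<eta> U" for V
        proof (cases "V \<in> ?nb U")
          case True
          then show ?thesis using pq U(3) by (intro close[of _ "real (fst c V)"]) (auto simp: cell_def)
        next
          case False
          have "fst p \<in> U" "fst q \<in> U" using pq WU by auto
          then show ?thesis using off[OF _ U(1) False] \<eta>[OF U(1)] by simp
        qed
        moreover have "\<bar>snd p - snd q\<bar> \<le> \<eta> U"
          using pq U(3) by (intro close[of _ "real (snd c)"]) (auto simp: cell_def)
        ultimately show ?thesis by blast
      qed
      ultimately show ?thesis using WU U(1) by blast
    qed
    ultimately show ?thesis by blast
  qed
  show ?thesis using main by (intro exI[of _ M]) blast
qed

text \<open>
  The map \<open>G (\<psi> x, s)\<close> varies on \<open>U \<times> [0,1]\<close> by an amount controlled by the weights and \<open>s\<close>,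
  since \<open>\<psi>\<close> maps \<open>U\<close> into a compact set, over which \<open>G\<close> is uniformly continuous and the radius
  \<open>\<rho> (M U)\<close> at the values of \<open>G\<close> is bounded away from \<open>0\<close>. A sufficiently fine cover thus meets
  the hypotheses of \<open>Lipschitz_approximation_of_fine_nerve\<close>.
\<close>

lemma homotopy_smoothing:
  fixes X :: "'a::metric_space set" and Y :: "'b::metric_space set"
  assumes good: "good_covering X \<U>" and Y: "locally_Lipschitz_contractible Y"
  shows "\<exists>\<Phi>. locally_Lipschitz_map (X \<times> {0..1::real}) X \<Phi> \<and> (\<forall>x\<in>X. \<Phi> (x, 0) = x) \<and>
    (\<forall>G :: 'a \<times> real \<Rightarrow> 'b. continuous_on (X \<times> {0..1}) G \<longrightarrow> G \<in> X \<times> {0..1} \<rightarrow> Y \<longrightarrow>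
     (\<exists>H. Lipschitz_approximation (X \<times> {0..1}) Y (\<lambda>p. G (\<Phi> (fst p, 1), snd p)) H))"
proof -
  have cov: "relatively_compact_cover X \<U>" by (rule good_covering_relatively_compact[OF good])
  then have UX: "\<Union>\<U> = X" by (simp add: relatively_compact_cover_def)
  let ?nb = "\<lambda>U. {V\<in>\<U>. V \<inter> U \<noteq> {}}"
  obtain t where t: "weighted_nerve X t" "\<forall>x\<in>X. supp (t x) = {U\<in>\<U>. x \<in> U}"
    using ex_dominant_weights[OF cov] by blast
  obtain \<Phi> :: "'a \<times> real \<Rightarrow> 'a" where \<Phi>: "locally_Lipschitz_map (X \<times> {0..1}) X \<Phi>" "\<forall>x\<in>X. \<Phi> (x, 0) = x"
    "\<forall>U\<in>\<U>. \<forall>x\<in>U. \<Phi> (x, 1) \<in> \<Union>(?nb U)"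
    "\<forall>U\<in>\<U>. \<exists>C\<ge>0. \<forall>x\<in>U. \<forall>z\<in>U. \<forall>\<delta><1/2. (\<forall>V. \<bar>t x V - t z V\<bar> \<le> \<delta>) \<longrightarrow>
       dist (\<Phi> (x, 1)) (\<Phi> (z, 1)) \<le> C * \<delta>"
    using good_covering_deformation[OF good t] by (elim exE conjE) (rule that)
  define \<psi> where "\<psi> x = \<Phi> (x, 1)" for x
  obtain C where C: "\<And>U. U \<in> \<U> \<Longrightarrow> 0 \<le> C U"
    "\<And>U x z \<delta>. U \<in> \<U> \<Longrightarrow> x \<in> U \<Longrightarrow> z \<in> U \<Longrightarrow> \<delta> < 1/2 \<Longrightarrow> \<forall>V. \<bar>t x V - t z V\<bar> \<le> \<delta> \<Longrightarrow>
       dist (\<psi> x) (\<psi> z) \<le> C U * \<delta>"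
    using \<Phi>(4) unfolding \<psi>_def by metis
  have \<psi>X: "\<psi> x \<in> X" if "x \<in> X" for x
    using \<Phi>(1) that by (auto simp: locally_Lipschitz_map_def \<psi>_def)
  have \<Phi>cont: "continuous_on (X \<times> {0..1}) \<Phi>"
    using locally_Lipschitz_map_imp_continuous_map[OF \<Phi>(1)] by simp
  have \<psi>cont: "continuous_on X \<psi>"
    unfolding \<psi>_def by (rule continuous_on_compose2[OF \<Phi>cont]) (auto intro: continuous_intros)
  obtain M where M: "\<forall>\<eta>. (\<forall>U\<in>\<U>. 0 < \<eta> U) \<longrightarrow> (\<exists>\<W>. relatively_compact_cover (X \<times> {0..1::real}) \<W> \<and>
    (\<forall>W\<in>\<W>. \<exists>U\<in>\<U>. W \<subseteq> U \<times> {0..1} \<and> (\<forall>p\<in>W. card {V\<in>\<W>. p \<in> V} \<le> M U) \<and>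
      (\<forall>p\<in>W. \<forall>q\<in>W. \<bar>snd p - snd q\<bar> \<le> \<eta> U \<and> (\<forall>V. \<bar>t (fst p) V - t (fst q) V\<bar> \<le> \<eta> U))))"
    using fine_product_cover[OF cov t] by (elim exE) (rule that)
  obtain \<rho> where ladder: "contraction_ladder Y \<rho>" using ex_contraction_ladder[OF Y] by blast
  have "\<exists>H. Lipschitz_approximation (X \<times> {0..1}) Y (\<lambda>p. G (\<psi> (fst p), snd p)) H"
    if G: "continuous_on (X \<times> {0..1}) G" "G \<in> X \<times> {0..1} \<rightarrow> Y" for G :: "'a \<times> real \<Rightarrow> 'b"
  proof -
    have "\<exists>\<eta>>0. \<forall>p\<in>U \<times> {0..1}. \<forall>q\<in>U \<times> {0..1}. \<bar>snd p - snd q\<bar> \<le> \<eta> \<longrightarrow>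
        (\<forall>V. \<bar>t (fst p) V - t (fst q) V\<bar> \<le> \<eta>) \<longrightarrow>
        dist (G (\<psi> (fst p), snd p)) (G (\<psi> (fst q), snd q)) < \<rho> (M U) (G (\<psi> (fst q), snd q)) / 4"
      if U: "U \<in> \<U>" for U
    proof -
      have "\<exists>K. compact K \<and> V \<subseteq> K \<and> K \<subseteq> X" if "V \<in> ?nb U" for V
        using cov that unfolding relatively_compact_cover_def by blast
      then obtain K where K: "\<And>V. V \<in> ?nb U \<Longrightarrow> compact (K V) \<and> V \<subseteq> K V \<and> K V \<subseteq> X" by metis
      define Q where "Q = (\<Union>V\<in>?nb U. K V) \<times> {0..1::real}"
      have "compact (\<Union>V\<in>?nb U. K V)" using finite_neighbours[OF cov U] K by (intro compact_UN) auto
      then have Q: "compact Q" unfolding Q_def by (intro compact_Times) auto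
      have QX: "Q \<subseteq> X \<times> {0..1}" using K unfolding Q_def by blast
      have GQ: "continuous_on Q G" by (rule continuous_on_subset[OF G(1) QX])
      have \<psi>K: "\<psi> x \<in> (\<Union>V\<in>?nb U. K V)" if "x \<in> U" for x
      proof -
        have "\<psi> x \<in> \<Union>(?nb U)" unfolding \<psi>_def by (rule bspec[OF bspec[OF \<Phi>(3) U] that])
        then obtain V where V: "V \<in> ?nb U" "\<psi> x \<in> V" by (rule UnionE)
        then have "\<psi> x \<in> K V" using K[OF V(1)] by blast
        then show ?thesis by (rule UN_I[OF V(1)])
      qed
      have \<psi>Q: "(\<psi> (fst p), snd p) \<in> Q" if "p \<in> U \<times> {0..1}" for p
      proof -
        have "fst p \<in> U" "snd p \<in> {0..1}" using that by (simp_all add: mem_Times_iff)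
        then show ?thesis unfolding Q_def using \<psi>K by (intro SigmaI)
      qed
      have "1-lipschitz_on Y (\<rho> (M U))"
      proof (rule lipschitz_onI)
        fix y z assume "y \<in> Y" "z \<in> Y"
        then show "dist (\<rho> (M U) y) (\<rho> (M U) z) \<le> 1 * dist y z"
          using contraction_ladderD(4)[OF ladder, of y z "M U"] contraction_ladderD(4)[OF ladder, of z y "M U"]
          by (auto simp: dist_real_def dist_commute)
      qed simp
      then have "continuous_on Y (\<rho> (M U))" by (rule lipschitz_on_continuous_on)
      then have \<rho>Q: "continuous_on Q (\<lambda>q. \<rho> (M U) (G q))"
        by (rule continuous_on_compose2[OF _ GQ]) (use G(2) QX in blast)
      have "\<exists>\<kappa>>0. \<forall>q\<in>Q. \<kappa> \<le> \<rho> (M U) (G q)"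
      proof (cases "Q = {}")
        case False
        then obtain q where q: "q \<in> Q" "\<forall>q'\<in>Q. \<rho> (M U) (G q) \<le> \<rho> (M U) (G q')"
          using continuous_attains_inf[OF Q False \<rho>Q] by blast
        moreover have "G q \<in> Y" using q(1) QX G(2) by blast
        then have "0 < \<rho> (M U) (G q)" by (rule contraction_ladderD(1)[OF ladder])
        ultimately show ?thesis by blast
      qed (auto intro: zero_less_one)
      then obtain \<kappa> where \<kappa>: "\<kappa> > 0" "\<And>q. q \<in> Q \<Longrightarrow> \<kappa> \<le> \<rho> (M U) (G q)" by blast
      have "uniformly_continuous_on Q G" by (rule compact_uniformly_continuous[OF GQ Q])
      moreover have "0 < \<kappa> / 4" using \<kappa>(1) by simp
      ultimately obtain d where d: "d > 0"
        "\<And>q q'. q \<in> Q \<Longrightarrow> q' \<in> Q \<Longrightarrow> dist q' q < d \<Longrightarrow> dist (G q') (G q) < \<kappa> / 4"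
        unfolding uniformly_continuous_on_def by metis
      \<comment> \<open>below \<open>1 / 2\<close> for the estimate on \<open>\<psi>\<close>, and such that weights and times closer than \<open>\<eta>\<close>
        keep \<open>(\<psi> x, s)\<close> within \<open>d\<close>\<close>
      define \<eta> where "\<eta> = min (1/4) (d / (2 * (C U + 1)))"
      have C0: "0 \<le> C U" by (rule C(1)[OF U])
      have \<eta>: "0 < \<eta>" "\<eta> < 1/2" using d(1) C0 by (auto simp: \<eta>_def)
      have "(C U + 1) * \<eta> \<le> (C U + 1) * (d / (2 * (C U + 1)))"
        using C0 by (intro mult_left_mono) (auto simp: \<eta>_def)
      also have "\<dots> = d / 2" using C0 by (simp add: field_simps)
      also have "\<dots> < d" using d(1) by simp
      finally have \<eta>d: "C U * \<eta> + \<eta> < d" by (simp add: algebra_simps)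
      have "dist (G (\<psi> (fst p), snd p)) (G (\<psi> (fst q), snd q)) < \<rho> (M U) (G (\<psi> (fst q), snd q)) / 4"
        if p: "p \<in> U \<times> {0..1}" and q: "q \<in> U \<times> {0..1}" and s: "\<bar>snd p - snd q\<bar> \<le> \<eta>"
          and V: "\<forall>V. \<bar>t (fst p) V - t (fst q) V\<bar> \<le> \<eta>" for p q
      proof -
        have "fst p \<in> U" "fst q \<in> U" using p q by auto
        then have "dist (\<psi> (fst p)) (\<psi> (fst q)) \<le> C U * \<eta>" using C(2)[OF U] \<eta>(2) V by blast
        then have "dist (\<psi> (fst p), snd p) (\<psi> (fst q), snd q) < d"
          using dist_Pair_le_add[of "\<psi> (fst p)" "snd p" "\<psi> (fst q)" "snd q"] s \<eta>d by linarith
        then have "dist (G (\<psi> (fst p), snd p)) (G (\<psi> (fst q), snd q)) < \<kappa> / 4"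
          by (rule d(2)[OF \<psi>Q[OF q] \<psi>Q[OF p]])
        then show ?thesis using \<kappa>(2)[OF \<psi>Q[OF q]] by linarith
      qed
      then show ?thesis using \<eta>(1) by blast
    qed
    then obtain \<eta> where \<eta>: "\<And>U. U \<in> \<U> \<Longrightarrow> \<eta> U > 0"
      "\<And>U p q. U \<in> \<U> \<Longrightarrow> p \<in> U \<times> {0..1} \<Longrightarrow> q \<in> U \<times> {0..1} \<Longrightarrow> \<bar>snd p - snd q\<bar> \<le> \<eta> U \<Longrightarrow>
        \<forall>V. \<bar>t (fst p) V - t (fst q) V\<bar> \<le> \<eta> U \<Longrightarrow>
        dist (G (\<psi> (fst p), snd p)) (G (\<psi> (fst q), snd q)) < \<rho> (M U) (G (\<psi> (fst q), snd q)) / 4"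
      by metis
    have "\<forall>U\<in>\<U>. 0 < \<eta> U" using \<eta>(1) by blast
    from mp[OF spec[OF M] this] obtain \<W> where \<W>: "relatively_compact_cover (X \<times> {0..1::real}) \<W>"
      "\<forall>W\<in>\<W>. \<exists>U\<in>\<U>. W \<subseteq> U \<times> {0..1} \<and> (\<forall>p\<in>W. card {V\<in>\<W>. p \<in> V} \<le> M U) \<and>
        (\<forall>p\<in>W. \<forall>q\<in>W. \<bar>snd p - snd q\<bar> \<le> \<eta> U \<and> (\<forall>V. \<bar>t (fst p) V - t (fst q) V\<bar> \<le> \<eta> U))"
      by (elim exE conjE) (rule that)
    from bchoice[OF \<W>(2)[unfolded Bex_def]] obtain u where u_all:
      "\<forall>W\<in>\<W>. u W \<in> \<U> \<and> W \<subseteq> u W \<times> {0..1} \<and> (\<forall>p\<in>W. card {V\<in>\<W>. p \<in> V} \<le> M (u W)) \<and>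
        (\<forall>p\<in>W. \<forall>q\<in>W. \<bar>snd p - snd q\<bar> \<le> \<eta> (u W) \<and>
          (\<forall>V. \<bar>t (fst p) V - t (fst q) V\<bar> \<le> \<eta> (u W)))"
      by (elim exE) (rule that)
    have u: "u W \<in> \<U>" "W \<subseteq> u W \<times> {0..1}"
      "\<And>p. p \<in> W \<Longrightarrow> card {V\<in>\<W>. p \<in> V} \<le> M (u W)"
      "\<And>p q. p \<in> W \<Longrightarrow> q \<in> W \<Longrightarrow> \<bar>snd p - snd q\<bar> \<le> \<eta> (u W)"
      "\<And>p q. p \<in> W \<Longrightarrow> q \<in> W \<Longrightarrow> \<forall>V. \<bar>t (fst p) V - t (fst q) V\<bar> \<le> \<eta> (u W)"
      if "W \<in> \<W>" for W
      using bspec[OF u_all that] by auto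
    obtain T where T: "weighted_nerve (X \<times> {0..1::real}) T"
        "\<And>p. p \<in> X \<times> {0..1} \<Longrightarrow> supp (T p) = {W\<in>\<W>. p \<in> W}"
      using ex_dominant_weights[OF \<W>(1)] by blast
    show ?thesis
    proof (rule Lipschitz_approximation_of_fine_nerve[OF T(1) ladder])
      show "(\<lambda>p. G (\<psi> (fst p), snd p)) \<in> X \<times> {0..1} \<rightarrow> Y" using G(2) \<psi>X by auto
      have "continuous_on (X \<times> {0..1::real}) (\<lambda>p. \<psi> (fst p))"
        by (rule continuous_on_compose2[OF \<psi>cont]) (auto intro: continuous_intros)
      then show "continuous_on (X \<times> {0..1}) (\<lambda>p. G (\<psi> (fst p), snd p))"
        by (intro continuous_on_compose2[OF G(1)] continuous_intros) (use \<psi>X in auto)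
      show "card (supp (T p)) \<le> M (u W)" if "p \<in> X \<times> {0..1}" "W \<in> supp (T p)" for p W
        using T(2)[OF that(1)] that(2) u(3) by auto
      show "dist (G (\<psi> (fst p), snd p)) (G (\<psi> (fst q), snd q)) < \<rho> (M (u W)) (G (\<psi> (fst q), snd q)) / 4"
        if "p \<in> X \<times> {0..1}" "q \<in> X \<times> {0..1}" "W \<in> supp (T p)" "W \<in> supp (T q)" for p q W
      proof -
        have W: "W \<in> \<W>" "p \<in> W" "q \<in> W" using T(2) that by auto
        show ?thesis
          by (rule \<eta>(2)[OF u(1)[OF W(1)]]) (use u(2)[OF W(1)] W u(4,5)[OF W] in auto)
      qed
    qed
  qed
  then show ?thesis
    using \<Phi>(1,2) unfolding \<psi>_def by (intro exI[of _ \<Phi>] conjI allI impI)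
qed

section \<open>Homotopy classes\<close>

lemma homotopic_with_canon_of_continuous_on:
  fixes h :: "'a::metric_space \<times> real \<Rightarrow> 'b::metric_space"
  assumes "continuous_on (X \<times> {0..1}) h" "h \<in> X \<times> {0..1} \<rightarrow> Y"
  shows "homotopic_with_canon (\<lambda>_. True) X Y (\<lambda>x. h (x, 0)) (\<lambda>x. h (x, 1))"
proof -
  have "continuous_on ({0..1} \<times> X) (\<lambda>p. h (snd p, fst p))"
    by (rule continuous_on_compose2[OF assms(1)]) (auto intro!: continuous_intros)
  then have "continuous_map (top_of_set ({0..1} \<times> X)) (top_of_set Y) (\<lambda>p. h (snd p, fst p))"
    using assms(2) by (auto simp: Pi_iff)
  moreover have "prod_topology (top_of_set {0..1::real}) (top_of_set X) = top_of_set ({0..1} \<times> X)"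
    by (simp add: subtopology_Times flip: euclidean_product_topology)
  ultimately show ?thesis
    unfolding homotopic_with_def by (intro exI[of _ "\<lambda>p. h (snd p, fst p)"]) auto
qed

lemma continuous_on_of_homotopic_with_canon:
  fixes f g :: "'a::metric_space \<Rightarrow> 'b::metric_space"
  assumes "homotopic_with_canon (\<lambda>_. True) X Y f g"
  shows "\<exists>G :: 'a \<times> real \<Rightarrow> 'b. continuous_on (X \<times> {0..1}) G \<and> G \<in> X \<times> {0..1} \<rightarrow> Y \<and>
    (\<forall>x. G (x, 0) = f x \<and> G (x, 1) = g x)"
proof -
  have T: "prod_topology (top_of_set {0..1::real}) (top_of_set X) = top_of_set ({0..1} \<times> X)"
    by (simp add: subtopology_Times flip: euclidean_product_topology)
  obtain k :: "real \<times> 'a \<Rightarrow> 'b" where k: "continuous_on ({0..1} \<times> X) k" "k \<in> {0..1} \<times> X \<rightarrow> Y"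
    "\<And>x. k (0, x) = f x" "\<And>x. k (1, x) = g x"
    using assms unfolding homotopic_with_def T by auto
  have "continuous_on (X \<times> {0..1}) (\<lambda>p. k (snd p, fst p))"
    by (rule continuous_on_compose2[OF k(1)]) (auto intro!: continuous_intros)
  then show ?thesis
    using k by (intro exI[of _ "\<lambda>p. k (snd p, fst p)"]) auto
qed

lemma isometric_imp_locally_Lipschitz_map:
  assumes "\<And>x z. x \<in> X \<Longrightarrow> z \<in> X \<Longrightarrow> dist (e x) (e z) = dist x z" "e \<in> X \<rightarrow> Z"
  shows "locally_Lipschitz_map X Z e"
  by (rule Lipschitz_imp_locally_Lipschitz_map[of 1])
    (use assms in \<open>auto simp: lipschitz_on_def\<close>)

lemma locally_Lipschitz_homotopic_trans:
  assumes "locally_Lipschitz_homotopic X Y f g" "locally_Lipschitz_homotopic X Y g h"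
  shows "locally_Lipschitz_homotopic X Y f h"
  using equivE[OF equiv_locally_Lipschitz_homotopy_rel[of X Y]] assms
  unfolding locally_Lipschitz_homotopy_rel_def by (auto dest: transD)

lemma locally_Lipschitz_homotopic_sym:
  assumes "locally_Lipschitz_homotopic X Y f g"
  shows "locally_Lipschitz_homotopic X Y g f"
  using equivE[OF equiv_locally_Lipschitz_homotopy_rel[of X Y]] assms
  unfolding locally_Lipschitz_homotopy_rel_def by (auto dest: symD)

lemma homotopic_imp_locally_Lipschitz_homotopic:
  fixes X :: "'a::metric_space set" and Y :: "'b::metric_space set"
  assumes good: "good_covering X \<U>" and Y: "locally_Lipschitz_contractible Y"
    and f: "locally_Lipschitz_map X Y f" and g: "locally_Lipschitz_map X Y g"
    and fg: "homotopic_with_canon (\<lambda>_. True) X Y f g"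
  shows "locally_Lipschitz_homotopic X Y f g"
proof -
  obtain \<Phi> :: "'a \<times> real \<Rightarrow> 'a" where \<Phi>: "locally_Lipschitz_map (X \<times> {0..1}) X \<Phi>" "\<forall>x\<in>X. \<Phi> (x, 0) = x"
    "\<forall>G :: 'a \<times> real \<Rightarrow> 'b. continuous_on (X \<times> {0..1}) G \<longrightarrow> G \<in> X \<times> {0..1} \<rightarrow> Y \<longrightarrow>
     (\<exists>H. Lipschitz_approximation (X \<times> {0..1}) Y (\<lambda>p. G (\<Phi> (fst p, 1), snd p)) H)"
    using homotopy_smoothing[OF good Y] by (elim exE conjE) (rule that)
  obtain G :: "'a \<times> real \<Rightarrow> 'b" where G: "continuous_on (X \<times> {0..1}) G" "G \<in> X \<times> {0..1} \<rightarrow> Y"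
    "\<forall>x. G (x, 0) = f x \<and> G (x, 1) = g x"
    using continuous_on_of_homotopic_with_canon[OF fg] by (elim exE conjE) (rule that)
  obtain H where "Lipschitz_approximation (X \<times> {0..1}) Y (\<lambda>p. G (\<Phi> (fst p, 1), snd p)) H"
    using mp[OF mp[OF spec[OF \<Phi>(3)] G(1)] G(2)] by (elim exE) (rule that)
  then have H: "\<forall>p\<in>X \<times> {0..1}. H (p, 0) = G (\<Phi> (fst p, 1), snd p)"
    "locally_Lipschitz_map (X \<times> {0..1}) Y (\<lambda>p. H (p, 1))"
    "\<forall>S\<subseteq>X \<times> {0..1}. locally_Lipschitz_map S Y (\<lambda>p. G (\<Phi> (fst p, 1), snd p)) \<longrightarrow>
      locally_Lipschitz_map (S \<times> {0..1}) Y H"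
    unfolding Lipschitz_approximation_def by simp_all
  have end1: "locally_Lipschitz_map X X (\<lambda>x. \<Phi> (x, 1))"
    by (rule locally_Lipschitz_map_compose[OF _ \<Phi>(1)], rule isometric_imp_locally_Lipschitz_map)
      (auto simp: dist_Pair_Pair)
  have pull: "locally_Lipschitz_homotopic X Y u (\<lambda>x. u (\<Phi> (x, 1)))" if u: "locally_Lipschitz_map X Y u" for u
    unfolding locally_Lipschitz_homotopic_def
    using locally_Lipschitz_map_compose[OF \<Phi>(1) u] \<Phi>(2)
    by (intro exI[of _ "\<lambda>p. u (\<Phi> p)"]) auto
  \<comment> \<open>\<open>H\<close> is locally Lipschitz over \<open>X \<times> {s}\<close> because it starts there with \<open>u\<close> composed with
    the end of \<open>\<Phi>\<close>, which is homotopic to \<open>u\<close> itself by \<open>pull\<close>\<close>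
  have slice: "locally_Lipschitz_homotopic X Y u (\<lambda>x. H ((x, s), 1))"
    if s: "s \<in> {0..1}" and u: "locally_Lipschitz_map X Y u" "\<And>x. G (x, s) = u x" for u s
  proof -
    have "locally_Lipschitz_map (X \<times> {s}) X fst"
      by (rule isometric_imp_locally_Lipschitz_map) (auto simp: dist_Pair_Pair)
    then have "locally_Lipschitz_map (X \<times> {s}) Y (\<lambda>p. u (\<Phi> (fst p, 1)))"
      using locally_Lipschitz_map_compose[OF _ locally_Lipschitz_map_compose[OF end1 u(1)]] by blast
    then have "locally_Lipschitz_map (X \<times> {s}) Y (\<lambda>p. G (\<Phi> (fst p, 1), snd p))"
      by (rule locally_Lipschitz_map_cong) (auto simp: u(2))
    then have HS: "locally_Lipschitz_map ((X \<times> {s}) \<times> {0..1}) Y H"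
      using H(3)[THEN spec, of "X \<times> {s}"] s by blast
    have "locally_Lipschitz_map (X \<times> {0..1::real}) ((X \<times> {s}) \<times> {0..1}) (\<lambda>p. ((fst p, s), snd p))"
      by (rule isometric_imp_locally_Lipschitz_map) (auto simp: dist_Pair_Pair)
    then have "locally_Lipschitz_map (X \<times> {0..1}) Y (\<lambda>p. H ((fst p, s), snd p))"
      using locally_Lipschitz_map_compose[OF _ HS] by blast
    then have "locally_Lipschitz_homotopic X Y (\<lambda>x. u (\<Phi> (x, 1))) (\<lambda>x. H ((x, s), 1))"
      unfolding locally_Lipschitz_homotopic_def using H(1) s u(2)
      by (intro exI[of _ "\<lambda>p. H ((fst p, s), snd p)"]) auto
    then show ?thesis using pull[OF u(1)] locally_Lipschitz_homotopic_trans by blast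
  qed
  have "locally_Lipschitz_homotopic X Y (\<lambda>x. H ((x, 0), 1)) (\<lambda>x. H ((x, 1), 1))"
    unfolding locally_Lipschitz_homotopic_def using H(2) by (intro exI[of _ "\<lambda>p. H (p, 1)"]) auto
  moreover have "locally_Lipschitz_homotopic X Y f (\<lambda>x. H ((x, 0), 1))"
    by (rule slice[OF _ f]) (use G(3) in auto)
  moreover have "locally_Lipschitz_homotopic X Y (\<lambda>x. H ((x, 1), 1)) g"
    by (rule locally_Lipschitz_homotopic_sym[OF slice[OF _ g]]) (use G(3) in auto)
  ultimately show ?thesis using locally_Lipschitz_homotopic_trans by blast
qed

lemma ex_homotopic_locally_Lipschitz_map:
  fixes X :: "'a::metric_space set" and Y :: "'b::metric_space set"
  assumes good: "good_covering X \<U>" and Y: "locally_Lipschitz_contractible Y"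
    and f: "continuous_map (top_of_set X) (top_of_set Y) f"
  shows "\<exists>g. locally_Lipschitz_map X Y g \<and> homotopic_with_canon (\<lambda>_. True) X Y f g"
proof -
  obtain \<Phi> :: "'a \<times> real \<Rightarrow> 'a" where \<Phi>: "locally_Lipschitz_map (X \<times> {0..1}) X \<Phi>" "\<forall>x\<in>X. \<Phi> (x, 0) = x"
    "\<forall>G :: 'a \<times> real \<Rightarrow> 'b. continuous_on (X \<times> {0..1}) G \<longrightarrow> G \<in> X \<times> {0..1} \<rightarrow> Y \<longrightarrow>
     (\<exists>H. Lipschitz_approximation (X \<times> {0..1}) Y (\<lambda>p. G (\<Phi> (fst p, 1), snd p)) H)"
    using homotopy_smoothing[OF good Y] by (elim exE conjE) (rule that)
  have fc: "continuous_on X f" "f \<in> X \<rightarrow> Y" using f by auto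
  have "continuous_on (X \<times> {0..1::real}) (\<lambda>p. f (fst p))"
    by (rule continuous_on_compose2[OF fc(1)]) (auto intro: continuous_intros)
  moreover have "(\<lambda>p. f (fst p)) \<in> X \<times> {0..1::real} \<rightarrow> Y" using fc(2) by auto
  ultimately have "\<exists>H. Lipschitz_approximation (X \<times> {0..1::real}) Y (\<lambda>p. f (\<Phi> (fst p, 1))) H"
    using \<Phi>(3)[THEN spec, of "\<lambda>p. f (fst p)"] by simp
  then obtain H where "Lipschitz_approximation (X \<times> {0..1::real}) Y (\<lambda>p. f (\<Phi> (fst p, 1))) H"
    by (elim exE) (rule that)
  then have H: "continuous_on ((X \<times> {0..1::real}) \<times> {0..1}) H" "H \<in> (X \<times> {0..1}) \<times> {0..1} \<rightarrow> Y"
    "\<forall>p\<in>X \<times> {0..1}. H (p, 0) = f (\<Phi> (fst p, 1))"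
    "locally_Lipschitz_map (X \<times> {0..1}) Y (\<lambda>p. H (p, 1))"
    unfolding Lipschitz_approximation_def by simp_all
  have \<Phi>c: "continuous_on (X \<times> {0..1}) \<Phi>" "\<Phi> \<in> X \<times> {0..1} \<rightarrow> X"
    using locally_Lipschitz_map_imp_continuous_map[OF \<Phi>(1)] by auto
  have "homotopic_with_canon (\<lambda>_. True) X Y (\<lambda>x. f (\<Phi> (x, 0))) (\<lambda>x. f (\<Phi> (x, 1)))"
  proof (rule homotopic_with_canon_of_continuous_on)
    show "continuous_on (X \<times> {0..1}) (\<lambda>p. f (\<Phi> p))"
      by (rule continuous_on_compose2[OF fc(1) \<Phi>c(1)]) (use \<Phi>c(2) in auto)
    show "(\<lambda>p. f (\<Phi> p)) \<in> X \<times> {0..1} \<rightarrow> Y" using fc(2) \<Phi>c(2) by auto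
  qed
  then have 1: "homotopic_with_canon (\<lambda>_. True) X Y f (\<lambda>x. f (\<Phi> (x, 1)))"
    by (rule homotopic_with_eq) (use \<Phi>(2) in auto)
  have "homotopic_with_canon (\<lambda>_. True) X Y (\<lambda>x. H ((fst (x, 0::real), 0), snd (x, 0)))
      (\<lambda>x. H ((fst (x, 1::real), 0), snd (x, 1)))"
  proof (rule homotopic_with_canon_of_continuous_on)
    show "continuous_on (X \<times> {0..1}) (\<lambda>p. H ((fst p, 0), snd p))"
      by (rule continuous_on_compose2[OF H(1)]) (auto intro!: continuous_intros)
    show "(\<lambda>p. H ((fst p, 0), snd p)) \<in> X \<times> {0..1} \<rightarrow> Y" using H(2) by auto
  qed
  then have 2: "homotopic_with_canon (\<lambda>_. True) X Y (\<lambda>x. f (\<Phi> (x, 1))) (\<lambda>x. H ((x, 0), 1))"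
    by (rule homotopic_with_eq) (use H(3) in auto)
  have "locally_Lipschitz_map X Y (\<lambda>x. H ((x, 0), 1))"
    by (rule locally_Lipschitz_map_compose[OF _ H(4)], rule isometric_imp_locally_Lipschitz_map)
      (auto simp: dist_Pair_Pair)
  then show ?thesis using homotopic_with_trans[OF 1 2] by blast
qed

theorem corollary1p5:
  fixes X :: "'a::metric_space set" and Y :: "'b::metric_space set"
  assumes "sigma_compact X"
    and "\<exists>\<U>. good_covering X \<U>"
    and "locally_Lipschitz_contractible Y"
  shows "bij_betw (natural_map X Y)
           (locally_Lipschitz_homotopy_classes X Y) (homotopy_classes X Y)
       \<and> (\<forall>f. continuous_map (top_of_set X) (top_of_set Y) f \<longrightarrow>
            (\<exists>g. locally_Lipschitz_map X Y g \<and> homotopic_with_canon (\<lambda>_. True) X Y f g))"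
proof -
  obtain \<U> where good: "good_covering X \<U>" using assms(2) by blast
  let ?R = "locally_Lipschitz_homotopy_rel X Y" and ?S = "homotopy_rel X Y"
  have smooth: "\<exists>g. locally_Lipschitz_map X Y g \<and> homotopic_with_canon (\<lambda>_. True) X Y f g"
    if "continuous_map (top_of_set X) (top_of_set Y) f" for f
    by (rule ex_homotopic_locally_Lipschitz_map[OF good assms(3) that])
  have "inj_on (natural_map X Y) (locally_Lipschitz_homotopy_classes X Y)"
  proof (rule inj_onI)
    fix C D assume C: "C \<in> locally_Lipschitz_homotopy_classes X Y"
      and D: "D \<in> locally_Lipschitz_homotopy_classes X Y" and eq: "natural_map X Y C = natural_map X Y D"
    obtain f where f: "locally_Lipschitz_map X Y f" "C = ?R `` {f}"
      using C unfolding locally_Lipschitz_homotopy_classes_def by (auto elim: quotientE)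
    obtain g where g: "locally_Lipschitz_map X Y g" "D = ?R `` {g}"
      using D unfolding locally_Lipschitz_homotopy_classes_def by (auto elim: quotientE)
    have "?S `` {f} = ?S `` {g}"
      using eq f(2) g(2) natural_map_class[OF f(1)] natural_map_class[OF g(1)] by simp
    then have "(f, g) \<in> ?S"
      by (rule eq_equiv_class[OF _ equiv_homotopy_rel])
        (simp add: locally_Lipschitz_map_imp_continuous_map[OF g(1)] del: continuous_map_subtopology_eu)
    then have "homotopic_with_canon (\<lambda>_. True) X Y f g" by (simp add: homotopy_rel_def)
    then have "locally_Lipschitz_homotopic X Y f g"
      by (rule homotopic_imp_locally_Lipschitz_homotopic[OF good assms(3) f(1) g(1)])
    then have "(f, g) \<in> ?R" by (simp add: locally_Lipschitz_homotopy_rel_def)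
    then show "C = D" using equiv_class_eq[OF equiv_locally_Lipschitz_homotopy_rel] f(2) g(2) by blast
  qed
  moreover have "natural_map X Y ` locally_Lipschitz_homotopy_classes X Y = homotopy_classes X Y"
  proof (intro subset_antisym subsetI)
    fix E assume "E \<in> natural_map X Y ` locally_Lipschitz_homotopy_classes X Y"
    then obtain f where f: "locally_Lipschitz_map X Y f" "E = natural_map X Y (?R `` {f})"
      unfolding locally_Lipschitz_homotopy_classes_def by (auto elim!: quotientE)
    then show "E \<in> homotopy_classes X Y"
      unfolding homotopy_classes_def natural_map_class[OF f(1)] f(2)
      using locally_Lipschitz_map_imp_continuous_map[OF f(1)] by (intro quotientI) simp
  next
    fix E assume "E \<in> homotopy_classes X Y"
    then obtain f where f: "continuous_map (top_of_set X) (top_of_set Y) f" "E = ?S `` {f}"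
      unfolding homotopy_classes_def by (auto elim!: quotientE)
    obtain g where g: "locally_Lipschitz_map X Y g" "homotopic_with_canon (\<lambda>_. True) X Y f g"
      using smooth[OF f(1)] by blast
    have "(f, g) \<in> ?S" using g(2) by (simp add: homotopy_rel_def)
    then have "E = ?S `` {g}" using equiv_class_eq[OF equiv_homotopy_rel] f(2) by blast
    also have "\<dots> = natural_map X Y (?R `` {g})" by (rule natural_map_class[OF g(1), symmetric])
    finally show "E \<in> natural_map X Y ` locally_Lipschitz_homotopy_classes X Y"
      using g(1) unfolding locally_Lipschitz_homotopy_classes_def by (auto intro: quotientI)
  qed
  ultimately show ?thesis using smooth by (simp add: bij_betw_def)
qed

end
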